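(* Let $\ell, s, r$ be positive integers with $s$ and $\ell$ coprime and let $a>0$, $b>0$ be real numbers. For $\lambda>0$ let $f_\lambda:\mathbb{C}^2\to\mathbb{C}$ be the polynomial in $u,v,\overline{v}$ associated with $(s,r,\ell,a,b,\lambda)$ as defined in the context. Then there exists $\epsilon>0$ such that for all $0<\lambda<\epsilon$ the set $f_\lambda^{-1}(0)\cap S^3$ is a link in $S^3$ ambient isotopic to the lemniscate link $K=L(s,r,\ell)$.
   Context: $S^3=\{(u,v)\in\mathbb{C}^2: |u|^2+|v|^2=1\}$. For $j=1,\dots,s$, $h\in[0,2\pi]$ and $\lambda>0$ put $$Z_{\lambda,j}(h)=\lambda\left(a\cos\left(\frac{rh+2\pi(j-1)}{s}\right)+\mathrm{i}\,\frac{b}{\ell}\sin\left(\frac{\ell\,(rh+2\pi(j-1))}{s}\right)\right),\qquad p_\lambda(u,h)=\prod_{j=1}^s\bigl(u-Z_{\lambda,j}(h)\bigr).$$ The function $p_\lambda$ can be written uniquely as a polynomial in $u$ whose coefficients are Laurent polynomials in $\mathrm{e}^{\mathrm{i}h}$ (i.e. finite linear combinations of $\mathrm{e}^{\mathrm{i}kh}$, $k\in\mathbb{Z}$). The polynomial $f_\lambda(u,v)$ in the variables $u,v,\overline{v}$ is obtained by replacing $\mathrm{e}^{\mathrm{i}kh}$ by $v^k$ for $k\ge 0$ and by $\overline{v}^{\,|k|}$ for $k<0$ (so no monomial contains the product $v\overline{v}$). The lemniscate link $L(s,r,\ell)$ (with $b>0$) is the closure of the braid with the $s$ strands $(X_j(h),Y_j(h),h)$,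 $0\le h\le 2\pi$, where $X_j=\operatorname{Re}Z_{1,j}$, $Y_j=\operatorname{Im}Z_{1,j}$. Explicitly it is the link in $\mathbb{R}^3$ given by $$\bigcup_{j=1}^s\{(\cos(h)(R+X_j(h)),\ \sin(h)(R+X_j(h)),\ Y_j(h)) : h\in[0,2\pi]\},$$ with $R>0$ large enough that $R+X_j(h)>0$ for all $j,h$. It is regarded as a link in $S^3$ via the stereographic identification $\mathbb{R}^3\to S^3\setminus\{(1,0)\}$, $u=\frac{\varrho^2-1+2\mathrm{i}z}{\varrho^2+1}$, $v=\frac{2(x+\mathrm{i}y)}{\varrho^2+1}$, $\varrho^2=x^2+y^2+z^2$. Its isotopy type does not depend on $R$ or on the positive values of $a,b$. *)

theory Defs
  imports
    "HOL-Analysis.Analysis"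
    "HOL-Computational_Algebra.Polynomial"
    "HOL-Library.Poly_Mapping"
begin

section \<open>The polynomials \<open>f\<^sub>\<lambda>\<close>\<close>

definition lemn_Z :: "real \<Rightarrow> real \<Rightarrow> nat \<Rightarrow> nat \<Rightarrow> nat \<Rightarrow> real \<Rightarrow> nat \<Rightarrow> real \<Rightarrow> complex" where
  "lemn_Z a b s r l lam j h =
     of_real lam *
       (of_real (a * cos ((real r * h + 2 * pi * (real j - 1)) / real s)) +
        \<i> * of_real (b / real l * sin (real l * (real r * h + 2 * pi * (real j - 1)) / real s)))"

definition lemn_p :: "real \<Rightarrow> real \<Rightarrow> nat \<Rightarrow> nat \<Rightarrow> nat \<Rightarrow> real \<Rightarrow> complex \<Rightarrow> real \<Rightarrow> complex" where
  "lemn_p a b s r l lam u h = (\<Prod>j = 1..s. u - lemn_Z a b s r l lam j h)"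

text \<open>
  A Laurent polynomial \<open>\<Sum>\<^sub>k c\<^sub>k e\<^sup>i\<^sup>k\<^sup>h\<close> is encoded by its finitely supported coefficient
  function \<open>c :: int \<Rightarrow>\<^sub>0 complex\<close>.  The argument \<open>\<phi>\<close> below is what is substituted for the
  powers \<open>e\<^sup>i\<^sup>k\<^sup>h\<close>; it need not be multiplicative in \<open>k\<close>.
\<close>

definition subst_laurent :: "(int \<Rightarrow> complex) \<Rightarrow> (int \<Rightarrow>\<^sub>0 complex) \<Rightarrow> complex" where
  "subst_laurent \<phi> c = (\<Sum>k\<in>Poly_Mapping.keys c. Poly_Mapping.lookup c k * \<phi> k)"

definition subst_poly :: "(int \<Rightarrow> complex) \<Rightarrow> (int \<Rightarrow>\<^sub>0 complex) poly \<Rightarrow> complex \<Rightarrow> complex" where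
  "subst_poly \<phi> P u = poly (map_poly (subst_laurent \<phi>) P) u"

definition represents_p ::
  "real \<Rightarrow> real \<Rightarrow> nat \<Rightarrow> nat \<Rightarrow> nat \<Rightarrow> real \<Rightarrow> (int \<Rightarrow>\<^sub>0 complex) poly \<Rightarrow> bool" where
  "represents_p a b s r l lam P \<longleftrightarrow>
     (\<forall>u. \<forall>h\<in>{0..2*pi}. subst_poly (\<lambda>k. cis (of_int k * h)) P u = lemn_p a b s r l lam u h)"

definition laurent_form ::
  "real \<Rightarrow> real \<Rightarrow> nat \<Rightarrow> nat \<Rightarrow> nat \<Rightarrow> real \<Rightarrow> (int \<Rightarrow>\<^sub>0 complex) poly" where
  "laurent_form a b s r l lam = (THE P. represents_p a b s r l lam P)"

subsection \<open>Existence and uniqueness of the Laurent form\<close>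

lemma subst_laurent_superset:
  assumes "finite A" "Poly_Mapping.keys c \<subseteq> A"
  shows "subst_laurent \<phi> c = (\<Sum>k\<in>A. Poly_Mapping.lookup c k * \<phi> k)"
  unfolding subst_laurent_def
  by (rule sum.mono_neutral_left) (use assms in \<open>auto simp: in_keys_iff\<close>)

lemma subst_laurent_0 [simp]: "subst_laurent \<phi> 0 = 0"
  by (simp add: subst_laurent_def)

lemma subst_laurent_single [simp]: "subst_laurent \<phi> (Poly_Mapping.single k x) = x * \<phi> k"
  by (simp add: subst_laurent_def)

lemma subst_laurent_add: "subst_laurent \<phi> (c + d) = subst_laurent \<phi> c + subst_laurent \<phi> d"
proof -
  let ?A = "Poly_Mapping.keys c \<union> Poly_Mapping.keys d"
  have "Poly_Mapping.keys (c + d) \<subseteq> ?A" by (rule Poly_Mapping.keys_add)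
  then show ?thesis
    by (simp add: subst_laurent_superset [of ?A] lookup_add sum.distrib algebra_simps)
qed

lemma subst_laurent_uminus: "subst_laurent \<phi> (- c) = - subst_laurent \<phi> c"
  using subst_laurent_add [of \<phi> c "- c"] by (simp add: add_eq_0_iff)

lemma subst_laurent_diff: "subst_laurent \<phi> (c - d) = subst_laurent \<phi> c - subst_laurent \<phi> d"
  using subst_laurent_add [of \<phi> c "- d"] by (simp add: subst_laurent_uminus)

lemma subst_laurent_sum: "subst_laurent \<phi> (\<Sum>i\<in>I. c i) = (\<Sum>i\<in>I. subst_laurent \<phi> (c i))"
  by (induction I rule: infinite_finite_induct) (auto simp: subst_laurent_add)

lemma laurent_decomp:
  "c = (\<Sum>k\<in>Poly_Mapping.keys c. Poly_Mapping.single k (Poly_Mapping.lookup c k))"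
proof (rule poly_mapping_eqI)
  fix j
  have "(\<Sum>k\<in>Poly_Mapping.keys c. Poly_Mapping.lookup c k when k = j) =
        (\<Sum>k\<in>Poly_Mapping.keys c. if k = j then Poly_Mapping.lookup c j else 0)"
    by (rule sum.cong) (auto simp: when_def)
  then show "Poly_Mapping.lookup c j = Poly_Mapping.lookup
    (\<Sum>k\<in>Poly_Mapping.keys c. Poly_Mapping.single k (Poly_Mapping.lookup c k)) j"
    by (auto simp: lookup_sum lookup_single in_keys_iff)
qed

lemma subst_laurent_mult:
  assumes "\<And>j k. \<phi> (j + k) = \<phi> j * \<phi> k"
  shows "subst_laurent \<phi> (c * d) = subst_laurent \<phi> c * subst_laurent \<phi> d"
proof -
  have "c * d = (\<Sum>j\<in>Poly_Mapping.keys c. \<Sum>k\<in>Poly_Mapping.keys d.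
      Poly_Mapping.single (j + k) (Poly_Mapping.lookup c j * Poly_Mapping.lookup d k))"
    by (subst laurent_decomp [of c], subst laurent_decomp [of d])
       (simp add: sum_product mult_single)
  then show ?thesis
    by (simp add: subst_laurent_sum assms)
       (simp add: subst_laurent_def sum_product algebra_simps)
qed

lemma subst_poly_mult:
  assumes "\<And>j k. \<phi> (j + k) = \<phi> j * \<phi> k"
  shows "subst_poly \<phi> (P * Q) u = subst_poly \<phi> P u * subst_poly \<phi> Q u"
proof -
  have "map_poly (subst_laurent \<phi>) (P * Q) =
        map_poly (subst_laurent \<phi>) P * map_poly (subst_laurent \<phi>) Q"
    by (rule poly_eqI) (simp add: coeff_map_poly coeff_mult subst_laurent_sum
        subst_laurent_mult [OF assms])
  then show ?thesis by (simp add: subst_poly_def)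
qed

lemma laurent_zero:
  assumes "infinite T" "inj_on cis T"
    and "\<And>t. t \<in> T \<Longrightarrow> subst_laurent (\<lambda>k. cis (of_int k * t)) c = 0"
  shows "c = 0"
proof -
  define K where "K = Poly_Mapping.keys c"
  define N where "N = (\<Sum>k\<in>K. nat \<bar>k\<bar>)"
  have N: "0 \<le> k + int N" if "k \<in> K" for k
  proof -
    have "nat \<bar>k\<bar> \<le> N" unfolding N_def
      by (rule member_le_sum) (use that in \<open>auto simp: K_def\<close>)
    then show ?thesis by linarith
  qed
  define q :: "complex poly" where
    "q = (\<Sum>k\<in>K. monom (Poly_Mapping.lookup c k) (nat (k + int N)))"
  have "poly q (cis t) = 0" if "t \<in> T" for t
  proof -
    have "poly q (cis t) = (\<Sum>k\<in>K. Poly_Mapping.lookup c k * cis (of_int (k + int N) * t))"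
      unfolding q_def poly_sum poly_monom
      by (rule sum.cong) (use N in \<open>auto simp: Complex.DeMoivre\<close>)
    also have "\<dots> = subst_laurent (\<lambda>k. cis (of_int k * t)) c * cis (of_nat N * t)"
      by (simp add: subst_laurent_def K_def sum_distrib_right cis_mult [symmetric]
          distrib_right mult.assoc)
    finally show ?thesis using assms(3) [OF that] by simp
  qed
  then have "cis ` T \<subseteq> {z. poly q z = 0}" by auto
  moreover have "infinite (cis ` T)" using assms by (simp add: finite_image_iff)
  ultimately have "q = 0" using poly_roots_finite [of q] finite_subset by blast
  have "Poly_Mapping.lookup c k = 0" if "k \<in> K" for k
  proof -
    have "0 = coeff q (nat (k + int N))" by (simp add: \<open>q = 0\<close>)
    also have "\<dots> = (\<Sum>j\<in>K. if j = k then Poly_Mapping.lookup c j else 0)"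
      unfolding q_def coeff_sum
      by (rule sum.cong) (use N that in \<open>auto simp: nat_eq_iff\<close>)
    also have "\<dots> = Poly_Mapping.lookup c k" using that by (simp add: K_def)
    finally show ?thesis by simp
  qed
  then show ?thesis unfolding K_def by (metis in_keys_iff lookup_zero poly_mapping_eqI)
qed

lemma subst_poly_unique:
  assumes "infinite T" "inj_on cis T"
    and "\<And>u t. t \<in> T \<Longrightarrow> subst_poly (\<lambda>k. cis (of_int k * t)) P u
                         = subst_poly (\<lambda>k. cis (of_int k * t)) Q u"
  shows "P = Q"
proof (rule poly_eqI)
  fix m
  have "coeff P m - coeff Q m = 0"
  proof (rule laurent_zero [OF assms(1,2)])
    fix t assume "t \<in> T"
    with assms(3) have "map_poly (subst_laurent (\<lambda>k. cis (of_int k * t))) P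
                      = map_poly (subst_laurent (\<lambda>k. cis (of_int k * t))) Q"
      by (auto simp: subst_poly_def fun_eq_iff simp flip: poly_eq_poly_eq_iff)
    then have "coeff (map_poly (subst_laurent (\<lambda>k. cis (of_int k * t))) P) m
                      = coeff (map_poly (subst_laurent (\<lambda>k. cis (of_int k * t))) Q) m"
      by simp
    then show "subst_laurent (\<lambda>k. cis (of_int k * t)) (coeff P m - coeff Q m) = 0"
      by (simp add: coeff_map_poly subst_laurent_diff)
  qed
  then show "coeff P m = coeff Q m" by simp
qed

lemma inj_cis: "inj_on cis {0..1}"
proof (rule inj_onI)
  fix x y :: real assume "x \<in> {0..1}" "y \<in> {0..1}" "cis x = cis y"
  then have "cos x = cos y" by (metis cis.sel(1))
  then show "x = y" using cos_inj_pi [of x y] \<open>x \<in> _\<close> \<open>y \<in> _\<close> pi_gt3 by auto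
qed

lemma represents_p_unique:
  assumes "represents_p a b s r l lam P" "represents_p a b s r l lam Q"
  shows "P = Q"
proof (rule subst_poly_unique [of "{0..1}"])
  fix u and t :: real assume "t \<in> {0..1}"
  then have "t \<in> {0..2*pi}" using pi_gt3 by auto
  then show "subst_poly (\<lambda>k. cis (of_int k * t)) P u = subst_poly (\<lambda>k. cis (of_int k * t)) Q u"
    using assms by (simp add: represents_p_def)
qed (use inj_cis in \<open>auto simp: infinite_Icc_iff\<close>)

lemma represents_p_exists:
  assumes "0 < s" "0 < l"
  shows "\<exists>P. represents_p a b s r l lam P"
proof -
  define \<alpha> where "\<alpha> j = 2 * pi * (real j - 1) / real s" for j
  define W where "W j t = of_real lam * (of_real (a * cos (t + \<alpha> j)) +
      \<i> * of_real (b / real l * sin (real l * (t + \<alpha> j))))" for j t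
  define G where "G u t = (\<Prod>j = 1..s. u - W j t)" for u t
  define z where "z j =
      Poly_Mapping.single 1 (lam * a / 2 * cis (\<alpha> j))
    + Poly_Mapping.single (- 1) (lam * a / 2 * cis (- \<alpha> j))
    + Poly_Mapping.single (int l) (lam * b / (2 * l) * cis (l * \<alpha> j))
    - Poly_Mapping.single (- int l) (lam * b / (2 * l) * cis (- (l * \<alpha> j)))" for j
  define P' where "P' = (\<Prod>j = 1..s. [:- z j, 1:])"
  have cisE: "cis (of_int (j + k) * t) = cis (of_int j * t) * cis (of_int k * t)" for j k t
    by (simp add: cis_mult distrib_right)
  have zW: "subst_laurent (\<lambda>k. cis (of_int k * t)) (z j) = W j t" for j t
  proof -
    have 1: "complex_of_real (cos x) = (cis x + cis (- x)) / 2"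
      and 2: "\<i> * complex_of_real (sin x) = (cis x - cis (- x)) / 2" for x
      by (simp_all add: complex_eq_iff)
    have "W j t = lam * (complex_of_real a * complex_of_real (cos (t + \<alpha> j)) + complex_of_real (b / l) * (\<i> * complex_of_real (sin (l * (t + \<alpha> j)))))"
      by (simp add: W_def)
    also have "\<dots> = lam * (a * ((cis (t + \<alpha> j) + cis (- (t + \<alpha> j))) / 2)
        + b / l * ((cis (l * (t + \<alpha> j)) - cis (- (l * (t + \<alpha> j)))) / 2))"
      unfolding 1 2 ..
    also have "cis (t + \<alpha> j) = cis t * cis (\<alpha> j)" by (simp add: cis_mult)
    also have "cis (- (t + \<alpha> j)) = cis (- t) * cis (- \<alpha> j)" by (simp add: cis_mult)
    also have "cis (l * (t + \<alpha> j)) = cis (l * t) * cis (l * \<alpha> j)" by (simp add: cis_mult distrib_left)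
    also have "cis (- (l * (t + \<alpha> j))) = cis (- (l * t)) * cis (- (l * \<alpha> j))"
      by (simp add: cis_mult distrib_left)
    finally show ?thesis
      using assms by (simp add: z_def subst_laurent_add subst_laurent_diff)
        (simp add: divide_simps, simp add: algebra_simps)
  qed
  have P'G: "subst_poly (\<lambda>k. cis (of_int k * t)) P' u = G u t" for u t
  proof -
    have 1: "subst_poly (\<lambda>k. cis (of_int k * t)) (1 :: (int \<Rightarrow>\<^sub>0 complex) poly) u = 1"
      by (simp add: subst_poly_def map_poly_1 subst_laurent_def)
    have "subst_poly (\<lambda>k. cis (of_int k * t)) (\<Prod>j\<in>A. [:- z j, 1:]) u = (\<Prod>j\<in>A. u - W j t)"
      if "finite A" for A
      using that
    proof (induction A)
      case (insert x A)
      have "subst_poly (\<lambda>k. cis (of_int k * t)) [:- z x, 1:] u = u - W x t"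
        by (simp add: subst_poly_def map_poly_pCons map_poly_1 subst_laurent_uminus zW)
          (simp add: subst_laurent_def)
      with insert show ?case
        by (simp add: subst_poly_mult cisE del: of_int_add mult_pCons_left)
    qed (simp add: 1)
    then show ?thesis by (simp add: P'_def G_def)
  qed
  have Gper: "G u (t + 2 * pi / s) = G u t" for u t
  proof -
    have W1: "W j (t + 2 * pi / s) = W (Suc j) t" for j
      by (simp add: W_def \<alpha>_def algebra_simps add_divide_distrib diff_divide_distrib)
    have W2: "W (Suc s) t = W 1 t"
    proof -
      have *: "t + \<alpha> (Suc s) = t + 2 * pi" "t + \<alpha> 1 = t" using assms by (simp_all add: \<alpha>_def)
      have "sin (l * (t + 2 * pi)) = sin (l * t + 2 * pi * l)"
        by (simp add: algebra_simps)
      also have "\<dots> = sin (l * t)" using sin_int_2pin[of "int l"] cos_int_2pin[of "int l"]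
        by (simp add: sin_add mult.commute [of _ "real l"] mult.left_commute [of _ "real l"])
      finally show ?thesis by (simp only: W_def *) simp
    qed
    have "G u (t + 2 * pi / s) = (\<Prod>j = 1..s. u - W (Suc j) t)" by (simp add: G_def W1)
    also have "\<dots> = (\<Prod>j = Suc 1..Suc s. u - W j t)" by (rule prod.shift_bounds_cl_Suc_ivl [symmetric])
    also have "\<dots> = (\<Prod>j = Suc 1..s. u - W j t) * (u - W (Suc s) t)"
      using assms by simp
    also have "\<dots> = (u - W 1 t) * (\<Prod>j = Suc 1..s. u - W j t)" by (simp add: W2)
    also have "\<dots> = G u t"
      unfolding G_def using assms by (simp add: prod.atLeast_Suc_atMost)
    finally show ?thesis .
  qed
  define tw where "tw c = (\<Sum>k\<in>Poly_Mapping.keys c.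
      Poly_Mapping.single k (Poly_Mapping.lookup c k * cis (of_int k * (2 * pi / s))))"
    for c :: "int \<Rightarrow>\<^sub>0 complex"
  have tw0: "tw 0 = 0" by (simp add: tw_def)
  have tw_look: "Poly_Mapping.lookup (tw c) k = Poly_Mapping.lookup c k * cis (of_int k * (2 * pi / s))" for c k
  proof -
    have "Poly_Mapping.lookup (tw c) k = (\<Sum>j\<in>Poly_Mapping.keys c.
      if j = k then Poly_Mapping.lookup c k * cis (of_int k * (2 * pi / s)) else 0)"
      unfolding tw_def lookup_sum lookup_single by (rule sum.cong) (auto simp: when_def)
    then show ?thesis by (auto simp: in_keys_iff)
  qed
  have tw_sub: "subst_laurent (\<lambda>k. cis (of_int k * t)) (tw c) =
      subst_laurent (\<lambda>k. cis (of_int k * (t + 2 * pi / s))) c" for t c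
    unfolding tw_def subst_laurent_sum subst_laurent_single subst_laurent_def [of _ c]
    by (simp add: cis_mult algebra_simps)
  have "map_poly tw P' = P'"
  proof (rule subst_poly_unique [of "{0..1}"])
    fix u and t :: real
    have "subst_poly (\<lambda>k. cis (of_int k * t)) (map_poly tw P') u =
      subst_poly (\<lambda>k. cis (of_int k * (t + 2 * pi / s))) P' u"
      unfolding subst_poly_def by (subst map_poly_map_poly) (auto simp: tw0 tw_sub o_def)
    then show "subst_poly (\<lambda>k. cis (of_int k * t)) (map_poly tw P') u
      = subst_poly (\<lambda>k. cis (of_int k * t)) P' u"
      by (simp only: P'G Gper)
  qed (use inj_cis in \<open>auto simp: infinite_Icc_iff\<close>)
  then have cf: "tw (coeff P' m) = coeff P' m" for m
    by (metis coeff_map_poly tw0)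
  have dv: "int s dvd k" if k: "k \<in> Poly_Mapping.keys (coeff P' m)" for k m
  proof -
    have "cis (of_int k * (2 * pi / s)) = 1"
      using tw_look [of "coeff P' m" k] cf [of m] k by (simp add: in_keys_iff)
    then have "cos (of_int k * (2 * pi / s)) = 1" by (metis cis.sel(1) one_complex.sel(1))
    then obtain n :: int where "of_int k * (2 * pi / s) = of_int n * 2 * pi"
      by (auto simp: cos_one_2pi_int)
    then have "of_int k = (of_int (n * int s) :: real)" using assms by (simp add: field_simps)
    then have "k = n * int s" by (simp only: of_int_eq_iff)
    then show ?thesis by simp
  qed
  define re where "re c = (\<Sum>k\<in>Poly_Mapping.keys c.
      Poly_Mapping.single (k div int s * int r) (Poly_Mapping.lookup c k))" for c :: "int \<Rightarrow>\<^sub>0 complex"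
  have re: "subst_laurent (\<lambda>k. cis (of_int k * h)) (re (coeff P' m)) =
      subst_laurent (\<lambda>k. cis (of_int k * (r * h / s))) (coeff P' m)" for h :: real and m
  proof -
    have "cis (of_int (k div int s * int r) * h) = cis (of_int k * (r * h / s))"
      if k: "k \<in> Poly_Mapping.keys (coeff P' m)" for k
    proof -
      obtain n where "k = int s * n" using dv [OF k] by (auto elim: dvdE)
      then show ?thesis using assms by (simp add: mult.assoc)
    qed
    then show ?thesis unfolding re_def subst_laurent_sum subst_laurent_single
      by (simp add: subst_laurent_def [of _ "coeff P' m"])
  qed
  have "represents_p a b s r l lam (map_poly re P')"
    unfolding represents_p_def
  proof (intro allI ballI)
    fix u :: complex and h :: real
    have re0: "re 0 = 0" by (simp add: re_def)
    have "map_poly (subst_laurent (\<lambda>k. cis (of_int k * h))) (map_poly re P') =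
          map_poly (subst_laurent (\<lambda>k. cis (of_int k * (r * h / s)))) P'"
      by (rule poly_eqI) (simp add: coeff_map_poly re0 re)
    then have "subst_poly (\<lambda>k. cis (of_int k * h)) (map_poly re P') u =
          subst_poly (\<lambda>k. cis (of_int k * (r * h / s))) P' u"
      by (simp only: subst_poly_def)
    also have "\<dots> = G u (r * h / s)" by (rule P'G)
    also have "\<dots> = lemn_p a b s r l lam u h"
      unfolding G_def lemn_p_def
    proof (rule prod.cong)
      fix j
      have "real r * h / s + \<alpha> j = (real r * h + 2 * pi * (real j - 1)) / real s"
        by (simp add: \<alpha>_def add_divide_distrib)
      then show "u - W j (r * h / s) = u - lemn_Z a b s r l lam j h"
        by (simp add: W_def lemn_Z_def)
    qed simp
    finally show "subst_poly (\<lambda>k. cis (of_int k * h)) (map_poly re P') u = lemn_p a b s r l lam u h" .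
  qed
  then show ?thesis ..
qed

lemma represents_p_ex1:
  assumes "0 < s" "0 < l"
  shows "\<exists>!P. represents_p a b s r l lam P"
  using represents_p_exists [OF assms] represents_p_unique by blast

lemma laurent_form_represents:
  assumes "0 < s" "0 < l"
  shows "represents_p a b s r l lam (laurent_form a b s r l lam)"
  unfolding laurent_form_def by (rule theI') (rule represents_p_ex1 [OF assms])

subsection \<open>Replacing powers of \<open>e\<^sup>i\<^sup>h\<close> by powers of \<open>v\<close> and its conjugate\<close>

definition lemn_f ::
  "real \<Rightarrow> real \<Rightarrow> nat \<Rightarrow> nat \<Rightarrow> nat \<Rightarrow> real \<Rightarrow> complex \<times> complex \<Rightarrow> complex" where
  "lemn_f a b s r l lam = (\<lambda>(u, v).
     subst_poly (\<lambda>k. if 0 \<le> k then v ^ nat k else cnj v ^ nat \<bar>k\<bar>) (laurent_form a b s r l lam) u)"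

section \<open>Links in the three-sphere\<close>

definition S3 :: "(complex \<times> complex) set" where
  "S3 = {(u, v). (cmod u)\<^sup>2 + (cmod v)\<^sup>2 = 1}"

text \<open>
  Links are topological here; tameness is not part of the definition.  A set that is ambient
  isotopic to one of the smooth links below is automatically tame.
\<close>

definition is_link :: "(complex \<times> complex) set \<Rightarrow> bool" where
  "is_link L \<longleftrightarrow> L \<subseteq> S3 \<and>
     (\<exists>\<C>. finite \<C> \<and> \<C> \<noteq> {} \<and> disjoint \<C> \<and> \<Union>\<C> = L \<and>
          (\<forall>C\<in>\<C>. C homeomorphic sphere (0::complex) 1))"

definition ambient_isotopic ::
  "'a::topological_space set \<Rightarrow> 'a set \<Rightarrow> 'a set \<Rightarrow> bool" where
  "ambient_isotopic M A B \<longleftrightarrow> A \<subseteq> M \<and> B \<subseteq> M \<and>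
     (\<exists>H :: real \<times> 'a \<Rightarrow> 'a.
        continuous_on ({0..1} \<times> M) H \<and>
        (\<forall>t\<in>{0..1}. \<exists>g. homeomorphism M M (\<lambda>x. H (t, x)) g) \<and>
        (\<forall>x\<in>M. H (0, x) = x) \<and>
        (\<lambda>x. H (1, x)) ` A = B)"

section \<open>Lemniscate links\<close>

definition stereo :: "real \<times> real \<times> real \<Rightarrow> complex \<times> complex" where
  "stereo = (\<lambda>(x, y, z). let q = x\<^sup>2 + y\<^sup>2 + z\<^sup>2 in
     ((of_real (q - 1) + 2 * \<i> * of_real z) / of_real (q + 1),
      2 * (of_real x + \<i> * of_real y) / of_real (q + 1)))"

definition closed_braid ::
  "real \<Rightarrow> real \<Rightarrow> nat \<Rightarrow> nat \<Rightarrow> nat \<Rightarrow> real \<Rightarrow> (real \<times> real \<times> real) set" where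
  "closed_braid a b s r l R =
     (\<Union>j\<in>{1..s}. {(cos h * (R + Re (lemn_Z a b s r l 1 j h)),
                     sin h * (R + Re (lemn_Z a b s r l 1 j h)),
                     Im (lemn_Z a b s r l 1 j h)) | h. h \<in> {0..2*pi}})"

text \<open>
  \<open>L(s,r,\<ell>)\<close> is only defined up to isotopy; \<open>K\<close> ranges over its representatives in \<open>S3\<close>,
  one for each admissible choice of \<open>a\<close>, \<open>b\<close> and \<open>R\<close>.
\<close>

definition is_lemniscate_link :: "nat \<Rightarrow> nat \<Rightarrow> nat \<Rightarrow> (complex \<times> complex) set \<Rightarrow> bool" where
  "is_lemniscate_link s r l K \<longleftrightarrow>
     (\<exists>a b R. 0 < a \<and> 0 < b \<and> 0 < R \<and>
        (\<forall>j\<in>{1..s}. \<forall>h\<in>{0..2*pi}. 0 < R + Re (lemn_Z a b s r l 1 j h)) \<and>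
        K = stereo ` closed_braid a b s r l R)"

end

theory Submission
  imports Defs
begin

text \<open>
  Both links lie in the complement of the circle \<open>v = 0\<close>, which is an open solid torus with the
  coordinates \<open>u\<close> in the open unit disc and \<open>y = v / |v|\<close> in the unit circle.  In these coordinates both
  are closed braids of the form \<open>braid r s W\<close>: over \<open>y\<close> lie the points \<open>W z\<close>, where \<open>z\<close> runs over the
  solutions of \<open>z\<^sup>s = y\<^sup>r\<close>.  With \<open>y = e\<^sup>i\<^sup>h\<close> the numbers \<open>z\<close> are the \<open>e\<^sup>i\<^sup>t\<close> with \<open>t = (rh + 2\<pi>(j - 1)) / s\<close>.

  The zero set is such a braid up to a small error.  Substituting \<open>u = \<lambda>w\<close> turns \<open>f\<^sub>\<lambda>\<close> into a multiple
  of \<open>f\<^sub>1(w, v)\<close>, which is monic in \<open>w\<close>; hence the zeros stay in a fixed disc and \<open>|v|\<close> differs from \<open>1\<close>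
  by \<open>O(\<lambda>\<^sup>2)\<close> at them.  For \<open>|v| = 1\<close> the polynomial is the product of the \<open>w - Z z\<close>, and its roots are
  simple: two strands can meet only at complex conjugate parameters \<open>z\<close>, and this is excluded by the
  coprimality of \<open>s\<close> and \<open>l\<close> (\<open>lemniscate_inj\<close>).  A Newton-like displacement, cut off near the
  strands, therefore moves the zero set to \<open>braid r s (\<lambda>z. \<lambda> Z z)\<close> (\<open>zero_set_isotopic_braid\<close>).

  Every representative of the lemniscate link is a closed braid of the same kind, with \<open>W\<close> the
  composition of a lemniscate with an injective map of a half-plane into the disc
  (\<open>stereo_closed_braid\<close>).  Explicit homotopies through braids join it to the small braid: the
  parameters are moved along a segment, and the half-plane is blown up at a point.

  Isotopies of the sphere are obtained without integrating vector fields.  A contraction of the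
  discs, added to the identity, is a bijection that can be switched on linearly
  (\<open>fibrewise_isotopy\<close>); a small motion of the strands is the restriction of such a map, and a
  homotopy of braids is a finite sequence of small motions (\<open>braid_homotopy\<close>).  Finally,
  \<open>is_link_braid\<close> finds the components of a closed braid, and they are transported by the isotopy.
\<close>

section \<open>Ambient isotopy as an equivalence relation\<close>

lemma compact_S3: "compact S3"
proof -
  have "S3 = sphere (0::complex \<times> complex) 1"
    by (auto simp: S3_def norm_prod_def)
  then show ?thesis by (metis compact_sphere)
qed

lemma ambient_isotopic_refl: "A \<subseteq> M \<Longrightarrow> ambient_isotopic M A A"
  unfolding ambient_isotopic_def
  by (intro conjI exI[of _ snd])
     (auto intro: continuous_on_snd homeomorphism_ident)

lemma ambient_isotopic_trans:
  fixes M :: "'a::topological_space set"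
  assumes "ambient_isotopic M A B" "ambient_isotopic M B C"
  shows "ambient_isotopic M A C"
proof -
  obtain H :: "real \<times> 'a \<Rightarrow> 'a" where H: "continuous_on ({0..1} \<times> M) H"
    "\<And>t. t \<in> {0..1} \<Longrightarrow> \<exists>g. homeomorphism M M (\<lambda>x. H (t, x)) g"
    "\<And>x. x \<in> M \<Longrightarrow> H (0, x) = x" "(\<lambda>x. H (1, x)) ` A = B"
    using assms(1) unfolding ambient_isotopic_def by blast
  obtain J :: "real \<times> 'a \<Rightarrow> 'a" where J: "continuous_on ({0..1} \<times> M) J"
    "\<And>t. t \<in> {0..1} \<Longrightarrow> \<exists>g. homeomorphism M M (\<lambda>x. J (t, x)) g"
    "\<And>x. x \<in> M \<Longrightarrow> J (0, x) = x" "(\<lambda>x. J (1, x)) ` B = C"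
    using assms(2) unfolding ambient_isotopic_def by blast
  have HM: "H (t, x) \<in> M" if "t \<in> {0..1}" "x \<in> M" for t x
    using H(2)[OF that(1)] that(2) by (auto simp: homeomorphism_def)
  define L where "L = (\<lambda>p. J (fst p, H p))"
  have "continuous_on ({0..1} \<times> M) L"
    unfolding L_def
    by (rule continuous_on_compose2[OF J(1)])
       (use H(1) HM in \<open>auto intro!: continuous_intros\<close>)
  moreover have "\<exists>g. homeomorphism M M (\<lambda>x. L (t, x)) g" if t: "t \<in> {0..1}" for t
  proof -
    obtain g where g: "homeomorphism M M (\<lambda>x. H (t, x)) g" using H(2)[OF t] by blast
    obtain k where k: "homeomorphism M M (\<lambda>x. J (t, x)) k" using J(2)[OF t] by blast
    from homeomorphism_compose[OF g k] show ?thesis by (auto simp: L_def o_def)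
  qed
  moreover have "L (0, x) = x" if "x \<in> M" for x using that by (simp add: L_def H(3) J(3))
  moreover have "(\<lambda>x. L (1, x)) ` A = C"
    using H(4) J(4) by (auto simp: L_def image_image[symmetric])
  ultimately show ?thesis
    using assms unfolding ambient_isotopic_def
    by (intro conjI exI[of _ L] ballI) simp_all
qed

text \<open>Running the isotopy backwards after undoing its final homeomorphism avoids any
  discussion of the joint continuity of the inverses.\<close>

lemma ambient_isotopic_sym:
  fixes M :: "'a::topological_space set"
  assumes "ambient_isotopic M A B"
  shows "ambient_isotopic M B A"
proof -
  obtain H :: "real \<times> 'a \<Rightarrow> 'a" where H: "continuous_on ({0..1} \<times> M) H"
    "\<And>t. t \<in> {0..1} \<Longrightarrow> \<exists>g. homeomorphism M M (\<lambda>x. H (t, x)) g"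
    "\<And>x. x \<in> M \<Longrightarrow> H (0, x) = x" "(\<lambda>x. H (1, x)) ` A = B" and AM: "A \<subseteq> M"
    using assms unfolding ambient_isotopic_def by blast
  obtain g where g: "homeomorphism M M (\<lambda>x. H (1, x)) g" using H(2)[of 1] by auto
  have gM: "g x \<in> M" if "x \<in> M" for x using g that by (auto simp: homeomorphism_def)
  define L where "L = (\<lambda>p. H (1 - fst p, g (snd p)))"
  have "continuous_on ({0..1} \<times> M) (\<lambda>p. g (snd p))"
    by (rule continuous_on_compose2[OF homeomorphism_cont2[OF g]]) (auto intro!: continuous_intros)
  then have "continuous_on ({0..1} \<times> M) L"
    unfolding L_def
    by (intro continuous_on_compose2[OF H(1)]) (use gM in \<open>auto intro!: continuous_intros\<close>)
  moreover have "\<exists>k. homeomorphism M M (\<lambda>x. L (t, x)) k" if t: "t \<in> {0..1}" for t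
  proof -
    obtain k where k: "homeomorphism M M (\<lambda>x. H (1 - t, x)) k" using H(2)[of "1 - t"] t by auto
    from homeomorphism_compose[OF homeomorphism_symD[OF g] k] show ?thesis by (auto simp: L_def o_def)
  qed
  moreover have "L (0, x) = x" if "x \<in> M" for x
    using homeomorphism_apply2[OF g that] by (simp add: L_def)
  moreover have "(\<lambda>x. L (1, x)) ` B = A"
  proof -
    have "(\<lambda>x. L (1, x)) ` B = (\<lambda>x. H (0, g (H (1, x)))) ` A"
      using H(4) by (auto simp: L_def image_image[symmetric])
    also have "\<dots> = (\<lambda>x. x) ` A"
    proof (rule image_cong)
      fix x assume "x \<in> A"
      then have "x \<in> M" using AM by auto
      then show "H (0, g (H (1, x))) = x"
        using homeomorphism_apply1[OF g] H(3) by auto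
    qed simp
    finally show ?thesis by simp
  qed
  ultimately show ?thesis
    using assms unfolding ambient_isotopic_def
    by (intro conjI exI[of _ L] ballI) simp_all
qed

lemma is_link_ambient_isotopic:
  assumes "is_link L" "ambient_isotopic S3 L L'"
  shows "is_link L'"
proof -
  obtain H :: "real \<times> complex \<times> complex \<Rightarrow> complex \<times> complex" where
    H: "\<And>t. t \<in> {0..1} \<Longrightarrow> \<exists>g. homeomorphism S3 S3 (\<lambda>x. H (t, x)) g" "(\<lambda>x. H (1, x)) ` L = L'"
    and L': "L' \<subseteq> S3"
    using assms(2) unfolding ambient_isotopic_def by blast
  define f where "f = (\<lambda>x. H (1, x))"
  obtain g where g: "homeomorphism S3 S3 f g" using H(1)[of 1] by (auto simp: f_def)
  obtain \<C> where C: "finite \<C>" "\<C> \<noteq> {}" "disjoint \<C>" "\<Union>\<C> = L"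
    "\<And>C. C \<in> \<C> \<Longrightarrow> C homeomorphic sphere (0::complex) 1" and L: "L \<subseteq> S3"
    using assms(1) unfolding is_link_def by blast
  have inj: "inj_on f S3" using homeomorphism_apply1[OF g] by (metis inj_onI)
  have CS: "C \<subseteq> S3" if "C \<in> \<C>" for C using that C(4) L by auto
  have "disjoint ((`) f ` \<C>)"
    by (intro disjoint_image inj_on_subset[OF inj]) (use C(3,4) L in auto)
  moreover have "\<Union>((`) f ` \<C>) = L'" using C(4) H(2) by (auto simp: f_def)
  moreover have "C homeomorphic sphere (0::complex) 1" if C': "C \<in> (`) f ` \<C>" for C
  proof -
    obtain D where D: "D \<in> \<C>" "C = f ` D" using C' by blast
    have "homeomorphism D C f g"
      by (rule homeomorphism_of_subsets[OF g]) (use CS D in auto)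
    then have "C homeomorphic D" using homeomorphic_def homeomorphic_sym by blast
    then show ?thesis using C(5)[OF D(1)] homeomorphic_trans by blast
  qed
  ultimately show ?thesis using C(1,2) L' unfolding is_link_def
    by (intro conjI exI[of _ "(`) f ` \<C>"] ballI) simp_all
qed

section \<open>Fibrewise isotopies of the three-sphere\<close>

lemma bij_identity_plus_contraction:
  fixes g :: "'a::banach \<Rightarrow> 'a"
  assumes lip: "\<And>u u'. norm (g u - g u') \<le> \<kappa> * norm (u - u')" and "\<kappa> < 1"
  shows "bij (\<lambda>u. u + g u)"
proof (rule bijI)
  show "inj (\<lambda>u. u + g u)"
  proof (rule injI)
    fix u u' assume "u + g u = u' + g u'"
    then have "u - u' = g u' - g u" by (simp add: algebra_simps)
    then have "norm (u - u') = norm (g u - g u')" by (simp add: norm_minus_commute)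
    then have "norm (u - u') \<le> \<kappa> * norm (u - u')" using lip[of u u'] by simp
    then have "(1 - \<kappa>) * norm (u - u') \<le> 0" by (simp add: algebra_simps)
    then show "u = u'" using \<open>\<kappa> < 1\<close> by (simp add: mult_le_0_iff)
  qed
  show "surj (\<lambda>u. u + g u)"
    unfolding surj_def
  proof
    fix w
    have "\<exists>!u. w - g u = u"
    proof (rule banach_fix_type)
      show "\<forall>x y. dist (w - g x) (w - g y) \<le> max 0 \<kappa> * dist x y"
      proof (intro allI)
        fix x y
        have "dist (w - g x) (w - g y) \<le> \<kappa> * dist x y"
          using lip[of x y] by (simp add: dist_norm norm_minus_commute)
        also have "\<dots> \<le> max 0 \<kappa> * dist x y" by (intro mult_right_mono) auto
        finally show "dist (w - g x) (w - g y) \<le> max 0 \<kappa> * dist x y" .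
      qed
    qed (use \<open>\<kappa> < 1\<close> in auto)
    then obtain u where "w - g u = u" by blast
    then show "\<exists>u. w = u + g u" by (metis diff_add_cancel)
  qed
qed

text \<open>The point of the three-sphere over \<open>u\<close> in the unit disc whose second coordinate has
  direction \<open>y\<close>; off the circle \<open>v = 0\<close> these are coordinates on the sphere.\<close>

definition lift :: "complex \<Rightarrow> complex \<Rightarrow> complex \<times> complex" where
  "lift u y = (u, of_real (sqrt (1 - (cmod u)\<^sup>2)) * y)"

definition fibred :: "(complex \<Rightarrow> complex set) \<Rightarrow> (complex \<times> complex) set" where
  "fibred A = {lift u y | u y. cmod y = 1 \<and> u \<in> A y}"

lemma lift_in_S3: "cmod u \<le> 1 \<Longrightarrow> cmod y = 1 \<Longrightarrow> lift u y \<in> S3"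
  by (simp add: lift_def S3_def norm_mult power_mult_distrib abs_square_le_1)

lemma fibred_subset_S3: "(\<And>y. cmod y = 1 \<Longrightarrow> A y \<subseteq> ball 0 1) \<Longrightarrow> fibred A \<subseteq> S3"
  unfolding fibred_def using lift_in_S3 by fastforce

lemma fibred_cong: "(\<And>y. cmod y = 1 \<Longrightarrow> A y = B y) \<Longrightarrow> fibred A = fibred B"
  unfolding fibred_def by auto

lemma lift_sgn_of_S3:
  assumes "(u, v) \<in> S3"
  shows "lift u (sgn v) = (u, v)"
proof -
  have "1 - (cmod u)\<^sup>2 = (cmod v)\<^sup>2" using assms by (simp add: S3_def)
  then show ?thesis by (simp add: lift_def sgn_eq)
qed

lemma sgn_lift:
  assumes "cmod u < 1" "cmod y = 1"
  shows "sgn (snd (lift u y)) = y" "snd (lift u y) \<noteq> 0"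
proof -
  have "(cmod u)\<^sup>2 < 1" using assms by (simp add: abs_square_less_1)
  then have p: "sqrt (1 - (cmod u)\<^sup>2) > 0" by simp
  have "sgn (snd (lift u y)) = sgn (complex_of_real (sqrt (1 - (cmod u)\<^sup>2))) * sgn y"
    by (simp add: lift_def sgn_mult)
  also have "\<dots> = y" using p assms(2) by (simp add: sgn_of_real sgn_eq)
  finally show "sgn (snd (lift u y)) = y" .
  show "snd (lift u y) \<noteq> 0" using p assms(2) by (auto simp: lift_def)
qed

text \<open>A displacement of the discs with constant direction of \<open>v\<close>, if it is a contraction and
  vanishes near the boundary, can be switched on linearly: at each time the identity plus a
  contraction is a bijection of the plane, fixes a neighbourhood of the boundary circle of each
  disc, and therefore glues with the identity along the circle \<open>v = 0\<close>.\<close>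

lemma fibrewise_isotopy:
  fixes G :: "complex \<Rightarrow> complex \<Rightarrow> complex"
  assumes cont: "continuous_on (sphere 0 1 \<times> UNIV) (\<lambda>(y, u). G y u)"
    and lip: "\<And>y u u'. cmod y = 1 \<Longrightarrow> cmod (G y u - G y u') \<le> \<kappa> * cmod (u - u')" and "\<kappa> < 1"
    and supp: "\<And>y u. cmod y = 1 \<Longrightarrow> \<rho> \<le> cmod u \<Longrightarrow> G y u = 0" and "\<rho> < 1"
    and A: "\<And>y. cmod y = 1 \<Longrightarrow> A y \<subseteq> ball 0 1"
  shows "ambient_isotopic S3 (fibred A) (fibred (\<lambda>y. (\<lambda>u. u + G y u) ` A y))"
proof -
  \<comment> \<open>On the circle \<open>v = 0\<close> there is no direction \<open>y\<close>, and nothing is to be moved.\<close>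
  define D where "D t u v = u + of_real t * (if v = 0 then 0 else G (sgn v) u)" for t :: real and u v :: complex
  define H where "H = (\<lambda>(t, u, v). lift (D t u v) (sgn v))"
  have sg: "cmod (sgn v) = 1" if "v \<noteq> 0" for v :: complex using that by (simp add: norm_sgn)
  have bij: "bij (\<lambda>u. u + of_real t * G y u)" if "t \<in> {0..1}" "cmod y = 1" for t y
  proof (rule bij_identity_plus_contraction[OF _ \<open>\<kappa> < 1\<close>])
    fix u u'
    have "cmod (of_real t * G y u - of_real t * G y u') = t * cmod (G y u - G y u')"
      using that by (simp flip: right_diff_distrib add: norm_mult)
    also have "\<dots> \<le> 1 * cmod (G y u - G y u')" using that by (intro mult_right_mono) auto
    finally show "cmod (of_real t * G y u - of_real t * G y u') \<le> \<kappa> * cmod (u - u')"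
      using lip[OF that(2), of u u'] by simp
  qed
  have inj: "u = u'" if "t \<in> {0..1}" "cmod y = 1" "u + of_real t * G y u = u' + of_real t * G y u'"
    for t y u u'
    using injD[OF bij_is_inj[OF bij[OF that(1,2)]], of u u'] that(3) by blast
  have small: "cmod (u + of_real t * G y u) < 1 \<longleftrightarrow> cmod u < 1" if "t \<in> {0..1}" "cmod y = 1" for t y u
  proof (cases "\<rho> \<le> cmod u")
    case False
    have "cmod (u + of_real t * G y u) < 1"
    proof (rule ccontr)
      define w where "w = u + of_real t * G y u"
      assume "\<not> cmod (u + of_real t * G y u) < 1"
      then have *: "\<rho> \<le> cmod w" using \<open>\<rho> < 1\<close> by (simp add: w_def)
      then have "w + of_real t * G y w = u + of_real t * G y u"
        using supp[OF that(2)] by (simp add: w_def)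
      then have "w = u" by (rule inj[OF that])
      then show False using * False by simp
    qed
    then show ?thesis using False \<open>\<rho> < 1\<close> by simp
  qed (use supp that in auto)
  have less1: "cmod u < 1" if "(u, v) \<in> S3" "v \<noteq> 0" for u v
  proof -
    have "(cmod v)\<^sup>2 > 0" using that by simp
    moreover have "(cmod u)\<^sup>2 + (cmod v)\<^sup>2 = 1" using that by (simp add: S3_def)
    ultimately have "(cmod u)\<^sup>2 < 1" by linarith
    then show ?thesis by (simp add: abs_square_less_1)
  qed
  have HS: "H (t, x) \<in> S3" if "t \<in> {0..1}" "x \<in> S3" for t x
  proof -
    obtain u v where x: "x = (u, v)" by force
    show ?thesis
    proof (cases "v = 0")
      case True
      then show ?thesis using lift_sgn_of_S3[of u v] that by (simp add: x H_def D_def)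
    next
      case False
      then have "cmod u < 1" using less1 that by (simp add: x)
      then show ?thesis using False small[OF that(1) sg[OF False]] lift_in_S3 sg
        by (auto simp: x H_def D_def intro!: lift_in_S3 less_imp_le)
    qed
  qed
  have Hid: "H (t, u, v) = (u, v)" if "(u, v) \<in> S3" "\<rho> \<le> cmod u" for t u v
    using lift_sgn_of_S3[OF that(1)] supp[OF sg that(2)] by (cases "v = 0") (simp_all add: H_def D_def)
  have Hc: "continuous_on ({0..1} \<times> S3) H"
  proof -
    \<comment> \<open>Where \<open>v \<noteq> 0\<close> the formula is continuous, and near \<open>v = 0\<close> the map is the identity.\<close>
    let ?X = "{0..1::real} \<times> S3"
    let ?U = "?X \<inter> {p. snd (snd p) \<noteq> 0}" and ?V = "?X \<inter> {p. \<rho> < cmod (fst (snd p))}"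
    have UV: "?U \<union> ?V = ?X"
    proof -
      have "cmod u = 1" if "(cmod u)\<^sup>2 = 1" for u :: complex
        using that by (metis abs_norm_cancel abs_square_eq_1)
      then show ?thesis using \<open>\<rho> < 1\<close> by (force simp: S3_def)
    qed
    have "open {p :: real \<times> complex \<times> complex. snd (snd p) \<noteq> 0}"
      by (intro open_Collect_neq continuous_intros)
    then have oU: "openin (top_of_set (?U \<union> ?V)) ?U" unfolding UV by (rule openin_open_Int)
    have "open {p :: real \<times> complex \<times> complex. \<rho> < cmod (fst (snd p))}"
      by (intro open_Collect_less continuous_intros)
    then have oV: "openin (top_of_set (?U \<union> ?V)) ?V" unfolding UV by (rule openin_open_Int)
    have "continuous_on ?U (\<lambda>p. G (sgn (snd (snd p))) (fst (snd p)))"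
    proof -
      have "continuous_on ?U (\<lambda>p. (sgn (snd (snd p)), fst (snd p)))"
        by (intro continuous_intros) auto
      from continuous_on_compose2[OF cont this] show ?thesis using sg by fastforce
    qed
    then have "continuous_on ?U (\<lambda>p. lift (fst (snd p) + of_real (fst p) * G (sgn (snd (snd p))) (fst (snd p))) (sgn (snd (snd p))))"
      unfolding lift_def by (intro continuous_intros) auto
    then have cU: "continuous_on ?U H"
      by (rule continuous_on_eq) (auto simp: H_def D_def)
    have cV: "continuous_on ?V H"
      by (rule continuous_on_eq[of _ snd]) (auto intro!: continuous_intros simp: Hid)
    from continuous_on_Un_local_open[OF oU oV cU cV] show ?thesis unfolding UV .
  qed
  have Hlift: "H (t, lift u y) = lift (u + of_real t * G y u) y" if "cmod u < 1" "cmod y = 1" for t u y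
    using sgn_lift[OF that] by (auto simp: H_def D_def lift_def)
  have Hhom: "\<exists>g. homeomorphism S3 S3 (\<lambda>x. H (t, x)) g" if t: "t \<in> {0..1}" for t
  proof -
    have c: "continuous_on S3 (\<lambda>x. H (t, x))"
      by (rule continuous_on_compose2[OF Hc]) (use t in \<open>auto intro!: continuous_intros\<close>)
    have injH: "inj_on (\<lambda>x. H (t, x)) S3"
    proof (rule inj_onI)
      fix p q assume p: "p \<in> S3" and q: "q \<in> S3" and e: "H (t, p) = H (t, q)"
      have *: "snd (H (t, x)) = 0 \<longleftrightarrow> snd x = 0" if "x \<in> S3" for x
      proof -
        obtain u v where x: "x = (u, v)" by force
        show ?thesis
        proof (cases "v = 0")
          case True
          then show ?thesis by (simp add: x H_def lift_def)
        next
          case False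
          then have "H (t, x) = lift (u + of_real t * G (sgn v) u) (sgn v)"
            by (simp add: x H_def D_def)
          moreover have "cmod (u + of_real t * G (sgn v) u) < 1"
            using small[OF t sg[OF False]] less1[of u v] that False by (simp add: x)
          ultimately show ?thesis using sgn_lift(2)[OF _ sg[OF False]] False by (simp add: x)
        qed
      qed
      obtain u v u' v' where pq: "p = (u, v)" "q = (u', v')" by force
      show "p = q"
      proof (cases "v = 0")
        case True
        then have "v' = 0" using *[OF p] *[OF q] e by (simp add: pq)
        then show ?thesis using e True by (simp add: pq H_def D_def lift_def)
      next
        case False
        then have F': "v' \<noteq> 0" using *[OF p] *[OF q] e by (simp add: pq)
        have u1: "cmod u < 1" "cmod u' < 1" using less1 p q False F' by (auto simp: pq)
        let ?y = "sgn v" and ?y' = "sgn v'"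
        have e2: "lift (u + of_real t * G ?y u) ?y = lift (u' + of_real t * G ?y' u') ?y'"
          using e by (simp add: pq H_def D_def False F')
        have s1: "cmod (u + of_real t * G ?y u) < 1" and s2: "cmod (u' + of_real t * G ?y' u') < 1"
          using small[OF t sg] u1 False F' by auto
        then have y: "?y = ?y'"
          using sgn_lift(1)[OF s1 sg[OF False]] sgn_lift(1)[OF s2 sg[OF F']] e2 by simp
        have "u + of_real t * G ?y u = u' + of_real t * G ?y u'" using e2 y by (simp add: lift_def)
        then have "u = u'" by (rule inj[OF t sg[OF False]])
        then have "lift u ?y = lift u' ?y'" using y by simp
        then show ?thesis using lift_sgn_of_S3 p q unfolding pq by metis
      qed
    qed
    have surj: "(\<lambda>x. H (t, x)) ` S3 = S3"
    proof
      show "S3 \<subseteq> (\<lambda>x. H (t, x)) ` S3"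
      proof
        fix p assume p: "p \<in> S3"
        obtain u v where pq: "p = (u, v)" by force
        show "p \<in> (\<lambda>x. H (t, x)) ` S3"
        proof (cases "v = 0")
          case True
          then have "cmod u = 1 \<or> cmod u = - 1" using p by (simp add: pq S3_def power2_eq_1_iff)
          then have "cmod u = 1" using norm_ge_zero[of u] by linarith
          then have "H (t, p) = p" using Hid[of u v t] p \<open>\<rho> < 1\<close> by (simp add: pq)
          then show ?thesis using p by (metis image_eqI)
        next
          case False
          obtain w where w: "u = w + of_real t * G (sgn v) w"
            using bij_is_surj[OF bij[OF t sg[OF False]]] by (auto simp: surj_def)
          have "cmod w < 1" using small[OF t sg[OF False], of w] w[symmetric] less1[of u v] p False by (simp add: pq)
          then have "H (t, lift w (sgn v)) = p" "lift w (sgn v) \<in> S3"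
            using Hlift[of w "sgn v" t] sg[OF False] lift_sgn_of_S3[of u v] p w[symmetric]
            by (simp_all add: pq lift_in_S3)
          then show ?thesis by blast
        qed
      qed
    qed (use HS t in auto)
    from homeomorphism_compact[OF compact_S3 c surj injH] show ?thesis .
  qed
  have HA: "(\<lambda>x. H (1, x)) ` fibred A = fibred (\<lambda>y. (\<lambda>u. u + G y u) ` A y)"
  proof -
    have "(\<lambda>x. H (1, x)) ` fibred A = {H (1, lift u y) | u y. cmod y = 1 \<and> u \<in> A y}"
      unfolding fibred_def by blast
    also have "\<dots> = {lift (u + G y u) y | u y. cmod y = 1 \<and> u \<in> A y}"
    proof -
      have "H (1, lift u y) = lift (u + G y u) y" if "cmod y = 1" "u \<in> A y" for u y
        using A[OF that(1)] that Hlift[of u y 1] by auto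
      then show ?thesis by metis
    qed
    also have "\<dots> = fibred (\<lambda>y. (\<lambda>u. u + G y u) ` A y)" unfolding fibred_def by blast
    finally show ?thesis .
  qed
  have H0: "H (0, x) = x" if "x \<in> S3" for x
  proof -
    obtain u v where x: "x = (u, v)" by force
    show ?thesis using lift_sgn_of_S3[of u v] that by (cases "v = 0") (simp_all add: x H_def D_def)
  qed
  have "fibred (\<lambda>y. (\<lambda>u. u + G y u) ` A y) \<subseteq> S3"
  proof (rule fibred_subset_S3)
    fix y :: complex assume "cmod y = 1"
    then show "(\<lambda>u. u + G y u) ` A y \<subseteq> ball 0 1"
      using A[of y] small[of 1 y] by (auto simp: subset_iff)
  qed
  with fibred_subset_S3[OF A] show ?thesis
    unfolding ambient_isotopic_def
    by (intro conjI exI[of _ H] ballI) (use Hc Hhom H0 HA in simp_all)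
qed

section \<open>Closed braids over the circle\<close>

text \<open>The strands over \<open>y\<close> are indexed by the solutions of \<open>z\<^sup>s = y\<^sup>r\<close> rather than by numbers \<open>1, \<dots>, s\<close>:
  this needs neither a choice of an argument of \<open>y\<close> nor a description of the permutation of the
  strands after a full turn.\<close>

definition strands :: "nat \<Rightarrow> nat \<Rightarrow> complex \<Rightarrow> complex set" where
  "strands r s y = {z. z ^ s = y ^ r}"

definition braid :: "nat \<Rightarrow> nat \<Rightarrow> (complex \<Rightarrow> complex) \<Rightarrow> (complex \<times> complex) set" where
  "braid r s W = fibred (\<lambda>y. W ` strands r s y)"

lemma norm_strand:
  assumes "0 < s" "cmod y = 1" "z \<in> strands r s y"
  shows "cmod z = 1"
proof -
  have "z ^ s = y ^ r" using assms(3) by (simp add: strands_def)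
  then have "cmod (z ^ s) = cmod (y ^ r)" by simp
  then show ?thesis using assms power_eq_iff_eq_base[of s "cmod z" 1] by (simp add: norm_power)
qed

lemma strands_eq_image:
  assumes "z ^ s = y ^ r" "z \<noteq> 0"
  shows "strands r s y = (\<lambda>\<zeta>. \<zeta> * z) ` {\<zeta>. \<zeta> ^ s = 1}" "inj_on (\<lambda>\<zeta>. \<zeta> * z) {\<zeta>. \<zeta> ^ s = 1}"
proof -
  have "y ^ r \<noteq> 0" using assms by (metis power_not_zero)
  then have "w \<in> (\<lambda>\<zeta>. \<zeta> * z) ` {\<zeta>. \<zeta> ^ s = 1}" if "w ^ s = y ^ r" for w
    by (intro image_eqI[of _ _ "w / z"]) (use that assms in \<open>simp_all add: power_divide\<close>)
  then show "strands r s y = (\<lambda>\<zeta>. \<zeta> * z) ` {\<zeta>. \<zeta> ^ s = 1}"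
    using assms by (auto simp: strands_def power_mult_distrib)
  show "inj_on (\<lambda>\<zeta>. \<zeta> * z) {\<zeta>. \<zeta> ^ s = 1}"
    using assms by (auto simp: inj_on_def)
qed

lemma ex_strand:
  assumes "0 < s" "cmod y = 1"
  obtains z where "z ^ s = y ^ r" "cmod z = 1"
proof -
  have "y \<noteq> 0" using assms by auto
  then have y: "y = cis (Arg y)" using assms by (simp add: cis_Arg sgn_eq)
  show ?thesis
  proof
    show "cis (r * Arg y / s) ^ s = y ^ r"
      using assms by (subst (2) y) (simp add: Complex.DeMoivre)
  qed simp
qed

lemma strands_finite_card:
  assumes "0 < s" "cmod y = 1"
  shows "finite (strands r s y)" "card (strands r s y) = s"
proof -
  obtain z where z: "z ^ s = y ^ r" "cmod z = 1" using ex_strand[OF assms] .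
  then have z0: "z \<noteq> 0" by auto
  have "finite {\<zeta>::complex. \<zeta> ^ s = 1}" using assms(1)
    by (intro card_ge_0_finite) (simp add: card_roots_unity_eq)
  then show "finite (strands r s y)" using strands_eq_image[OF z(1) z0] by simp
  show "card (strands r s y) = s"
    using strands_eq_image[OF z(1) z0] assms(1) by (simp add: card_image card_roots_unity_eq)
qed

text \<open>The strands of a fibre have no global order, but a sum over all of them depends
  continuously on the fibre, because over the circle minus a point one of them can be chosen
  continuously and the others are its multiples by roots of unity.\<close>

lemma continuous_on_sum_strands:
  fixes F :: "complex \<Rightarrow> complex \<Rightarrow> complex \<Rightarrow> complex"
  assumes "0 < s"
    and F: "continuous_on (sphere 0 1 \<times> sphere 0 1 \<times> UNIV) (\<lambda>(z, y, u). F z y u)"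
  shows "continuous_on (sphere 0 1 \<times> UNIV) (\<lambda>(y, u). \<Sum>z\<in>strands r s y. F z y u)"
proof -
  have *: "continuous_on T (\<lambda>(y, u). \<Sum>z\<in>strands r s y. F z y u)"
    if c: "continuous_on T (\<lambda>p. \<theta> (fst p))" and T: "\<And>y u. (y, u) \<in> T \<Longrightarrow> y = cis (\<theta> y)"
    for T :: "(complex \<times> complex) set" and \<theta> :: "complex \<Rightarrow> real"
  proof -
    define b where "b y = cis (real r * \<theta> y / real s)" for y
    have b: "b y ^ s = y ^ r" if "(y, u) \<in> T" for y u
    proof -
      have "b y ^ s = cis (\<theta> y) ^ r" using \<open>0 < s\<close> by (simp add: b_def Complex.DeMoivre)
      then show ?thesis using T[OF that] by simp
    qed
    have b1: "cmod (b y) = 1" for y by (simp add: b_def)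
    have cb: "continuous_on T (\<lambda>p. b (fst p))"
      unfolding b_def cis_conv_exp by (intro continuous_intros c) (use \<open>0 < s\<close> in auto)
    have "continuous_on T (\<lambda>p. F (\<zeta> * b (fst p)) (fst p) (snd p))" if z: "\<zeta> ^ s = 1" for \<zeta>
    proof -
      have "cmod \<zeta> = 1" using power_eq_1_iff[OF z] \<open>0 < s\<close> by auto
      moreover have "cmod y = 1" if "(y, u) \<in> T" for y u using T[OF that] by (metis norm_cis)
      moreover have "continuous_on T (\<lambda>p. (\<zeta> * b (fst p), fst p, snd p))"
        by (intro continuous_intros cb)
      moreover have "(\<lambda>p. (\<zeta> * b (fst p), fst p, snd p)) ` T \<subseteq> sphere 0 1 \<times> sphere 0 1 \<times> UNIV"
        using calculation(1,2) by (auto simp: norm_mult b1)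
      ultimately show ?thesis
        using continuous_on_compose2[OF F, of T "\<lambda>p. (\<zeta> * b (fst p), fst p, snd p)"]
        by (simp add: split_beta)
    qed
    then have "continuous_on T (\<lambda>p. \<Sum>\<zeta> | \<zeta> ^ s = 1. F (\<zeta> * b (fst p)) (fst p) (snd p))"
      by (intro continuous_on_sum) auto
    then show ?thesis
    proof (rule continuous_on_eq)
      fix p assume p: "p \<in> T"
      obtain y u where yu: "p = (y, u)" by force
      have "b y \<noteq> 0" using b1[of y] by auto
      note im = strands_eq_image[OF b[OF p[unfolded yu]] this]
      show "(\<Sum>\<zeta> | \<zeta> ^ s = 1. F (\<zeta> * b (fst p)) (fst p) (snd p)) = (case p of (y, u) \<Rightarrow> \<Sum>z\<in>strands r s y. F z y u)"
        by (simp add: yu im(1) sum.reindex[OF im(2)])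
    qed
  qed
  let ?X = "sphere 0 1 \<times> UNIV :: (complex \<times> complex) set"
  let ?U = "?X \<inter> {p. fst p \<noteq> - 1}" and ?V = "?X \<inter> {p. fst p \<noteq> 1}"
  have UV: "?U \<union> ?V = ?X" by auto
  have "openin (top_of_set ?X) ?U" "openin (top_of_set ?X) ?V"
    by (intro openin_open_Int open_Collect_neq continuous_intros)+
  then have o: "openin (top_of_set (?U \<union> ?V)) ?U" "openin (top_of_set (?U \<union> ?V)) ?V"
    unfolding UV .
  have nonpos: "y \<notin> \<real>\<^sub>\<le>\<^sub>0" if "cmod y = 1" "y \<noteq> - 1" for y
    using that by (auto simp: nonpos_Reals_def)
  have nonpos': "- y \<notin> \<real>\<^sub>\<le>\<^sub>0" if "cmod y = 1" "y \<noteq> 1" for y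
    using nonpos[of "- y"] that by simp
  have Arg1: "cis (Arg y) = y" if "cmod y = 1" for y
  proof -
    have "y \<noteq> 0" using that by auto
    then show ?thesis using that by (simp add: cis_Arg sgn_eq)
  qed
  have "continuous_on ?U (\<lambda>p. Arg (fst p))"
    by (rule continuous_on_compose2[of "- \<real>\<^sub>\<le>\<^sub>0" Arg])
       (use nonpos continuous_at_Arg in \<open>auto intro!: continuous_intros continuous_at_imp_continuous_on\<close>)
  then have cU: "continuous_on ?U (\<lambda>(y, u). \<Sum>z\<in>strands r s y. F z y u)"
    by (rule *) (simp add: Arg1)
  have "continuous_on ?V (\<lambda>p. Arg (- fst p))"
  proof (rule continuous_on_compose2[of "- \<real>\<^sub>\<le>\<^sub>0" Arg])
    show "(\<lambda>p. - fst p) ` ?V \<subseteq> - \<real>\<^sub>\<le>\<^sub>0" using nonpos' by auto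
  qed (use continuous_at_Arg in \<open>auto intro!: continuous_intros continuous_at_imp_continuous_on\<close>)
  then have "continuous_on ?V (\<lambda>p. Arg (- fst p) + pi)"
    by (rule continuous_on_add[OF _ continuous_on_const])
  then have cV: "continuous_on ?V (\<lambda>(y, u). \<Sum>z\<in>strands r s y. F z y u)"
    by (rule *) (simp add: Arg1 flip: cis_mult)
  from continuous_on_Un_local_open[OF o cU cV] show ?thesis unfolding UV .
qed

definition bump :: "real \<Rightarrow> real \<Rightarrow> real" where
  "bump \<delta> x = max 0 (min 1 (2 - x / \<delta>))"

lemma bump_simps:
  assumes "0 < \<delta>"
  shows "x \<le> \<delta> \<Longrightarrow> bump \<delta> x = 1" "2 * \<delta> \<le> x \<Longrightarrow> bump \<delta> x = 0" "0 \<le> bump \<delta> x" "bump \<delta> x \<le> 1"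
  using assms by (auto simp: bump_def field_simps)

lemma bump_lipschitz:
  assumes "0 < \<delta>"
  shows "\<bar>bump \<delta> x - bump \<delta> x'\<bar> \<le> \<bar>x - x'\<bar> / \<delta>"
proof -
  have "\<bar>bump \<delta> x - bump \<delta> x'\<bar> \<le> \<bar>(2 - x / \<delta>) - (2 - x' / \<delta>)\<bar>"
    unfolding bump_def by linarith
  also have "\<dots> = \<bar>x - x'\<bar> / \<delta>" using assms by (simp add: abs_minus_commute flip: diff_divide_distrib)
  finally show ?thesis .
qed

text \<open>Small displacements \<open>d\<close>, prescribed near each strand of a closed braid, are cut off and
  added up.  The sum runs over all strands of a fibre and therefore is well defined on the
  fibres although the strands may be permuted along the circle.  As the cut-offs live on discs of
  radius \<open>2\<delta>\<close>, a separation of \<open>4\<delta>\<close> leaves a single summand at distance at most \<open>\<delta>\<close> from a strand, and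
  a margin of \<open>3\<delta>\<close> keeps the displacement away from the boundary of the unit disc.\<close>

locale strand_displacement =
  fixes r s :: nat and \<delta> :: real and W :: "complex \<Rightarrow> complex"
    and d :: "complex \<Rightarrow> complex \<Rightarrow> complex \<Rightarrow> complex"
  assumes s: "0 < s" and delta: "0 < \<delta>"
    and cont_W: "continuous_on (sphere 0 1) W"
    and cont_d: "continuous_on (sphere 0 1 \<times> sphere 0 1 \<times> UNIV) (\<lambda>(z, y, u). d z y u)"
    and inside: "\<And>z. cmod z = 1 \<Longrightarrow> cmod (W z) \<le> 1 - 3 * \<delta>"
    and separated: "\<And>y z z'. cmod y = 1 \<Longrightarrow> z \<in> strands r s y \<Longrightarrow> z' \<in> strands r s y \<Longrightarrow> z \<noteq> z' \<Longrightarrow>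
        4 * \<delta> \<le> cmod (W z - W z')"
    and small: "\<And>y z u. cmod y = 1 \<Longrightarrow> z \<in> strands r s y \<Longrightarrow> cmod (u - W z) \<le> 2 * \<delta> \<Longrightarrow>
        cmod (d z y u) \<le> \<delta> / (4 * s)"
    and lipschitz: "\<And>y z u u'. cmod y = 1 \<Longrightarrow> z \<in> strands r s y \<Longrightarrow> cmod (u - W z) \<le> 2 * \<delta> \<Longrightarrow>
        cmod (u' - W z) \<le> 2 * \<delta> \<Longrightarrow> cmod (d z y u - d z y u') \<le> cmod (u - u') / (4 * s)"
begin

definition piece :: "complex \<Rightarrow> complex \<Rightarrow> complex \<Rightarrow> complex" where
  "piece z y u = of_real (bump \<delta> (cmod (u - W z))) * d z y u"

definition total :: "complex \<Rightarrow> complex \<Rightarrow> complex" where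
  "total y u = (\<Sum>z\<in>strands r s y. piece z y u)"

lemma piece_bound:
  assumes "cmod y = 1" "z \<in> strands r s y"
  shows "cmod (piece z y u) \<le> \<delta> / (4 * s)"
proof (cases "cmod (u - W z) \<le> 2 * \<delta>")
  case True
  have "cmod (piece z y u) \<le> 1 * cmod (d z y u)"
    unfolding piece_def norm_mult using bump_simps[OF delta]
    by (intro mult_right_mono) auto
  then show ?thesis using small[OF assms True] by simp
qed (use bump_simps[OF delta] delta in \<open>auto simp: piece_def\<close>)

lemma piece_lipschitz:
  assumes "cmod y = 1" "z \<in> strands r s y"
  shows "cmod (piece z y u - piece z y u') \<le> cmod (u - u') / (2 * s)"
proof -
  let ?b = "\<lambda>u. bump \<delta> (cmod (u - W z))"
  have lb: "\<bar>?b u - ?b u'\<bar> \<le> cmod (u - u') / \<delta>" for u u'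
  proof -
    have "\<bar>cmod (u - W z) - cmod (u' - W z)\<bar> \<le> cmod (u - u')"
      using norm_triangle_ineq3[of "u - W z" "u' - W z"] by simp
    then have "\<bar>cmod (u - W z) - cmod (u' - W z)\<bar> / \<delta> \<le> cmod (u - u') / \<delta>"
      using delta by (simp add: divide_right_mono)
    then show ?thesis using bump_lipschitz[OF delta] order_trans by blast
  qed
  have in_left: "cmod (piece z y u - piece z y u') \<le> cmod (u - u') / (2 * s)"
    if u: "cmod (u - W z) \<le> 2 * \<delta>" for u u'
  proof -
    have 1: "\<bar>?b u - ?b u'\<bar> * cmod (d z y u) \<le> cmod (u - u') / (4 * s)"
    proof -
      have "\<bar>?b u - ?b u'\<bar> * cmod (d z y u) \<le> (cmod (u - u') / \<delta>) * (\<delta> / (4 * s))"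
        using lb small[OF assms u] delta by (intro mult_mono) auto
      then show ?thesis using delta by simp
    qed
    have 2: "?b u' * cmod (d z y u - d z y u') \<le> cmod (u - u') / (4 * s)"
    proof (cases "cmod (u' - W z) \<le> 2 * \<delta>")
      case True
      have "?b u' * cmod (d z y u - d z y u') \<le> 1 * cmod (d z y u - d z y u')"
        using bump_simps[OF delta] by (intro mult_right_mono) auto
      then show ?thesis using lipschitz[OF assms u True] by simp
    next
      case False
      then have "?b u' = 0" using bump_simps(2)[OF delta] by simp
      then show ?thesis by simp
    qed
    have "piece z y u - piece z y u' =
        of_real (?b u - ?b u') * d z y u + of_real (?b u') * (d z y u - d z y u')"
      by (simp add: piece_def algebra_simps)
    also have "cmod \<dots> \<le> \<bar>?b u - ?b u'\<bar> * cmod (d z y u) + ?b u' * cmod (d z y u - d z y u')"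
      using bump_simps(3)[OF delta]
      by (intro order_trans[OF norm_triangle_ineq]) (simp add: norm_mult del: of_real_diff)
    also have "\<dots> \<le> cmod (u - u') / (4 * s) + cmod (u - u') / (4 * s)" using 1 2 by simp
    also have "\<dots> = cmod (u - u') / (2 * s)" by (simp add: field_simps)
    finally show ?thesis .
  qed
  show ?thesis
  proof (cases "cmod (u - W z) \<le> 2 * \<delta>")
    case False
    show ?thesis
    proof (cases "cmod (u' - W z) \<le> 2 * \<delta>")
      case True
      then show ?thesis using in_left[OF True, of u] by (simp add: norm_minus_commute)
    next
      case F': False
      then have "piece z y u = 0" "piece z y u' = 0"
        using False bump_simps(2)[OF delta] by (simp_all add: piece_def)
      then show ?thesis by simp
    qed
  qed (rule in_left)
qed

lemma total_bound:
  assumes "cmod y = 1"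
  shows "cmod (total y u) \<le> \<delta> / 4"
proof -
  have "cmod (total y u) \<le> of_nat (card (strands r s y)) * (\<delta> / (4 * s))"
    unfolding total_def using piece_bound[OF assms] by (rule sum_norm_bound)
  then show ?thesis using strands_finite_card[OF s assms] s by simp
qed

lemma total_lipschitz:
  assumes "cmod y = 1"
  shows "cmod (total y u - total y u') \<le> 1 / 2 * cmod (u - u')"
proof -
  have "cmod (\<Sum>z\<in>strands r s y. piece z y u - piece z y u') \<le>
      of_nat (card (strands r s y)) * (cmod (u - u') / (2 * s))"
    using piece_lipschitz[OF assms] by (rule sum_norm_bound)
  then show ?thesis using strands_finite_card[OF s assms] s by (simp add: total_def sum_subtractf)
qed

text \<open>Close to a strand the cut-off is invisible, so that \<open>d\<close> alone decides where points go.\<close>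

lemma total_near:
  assumes "cmod y = 1" "z \<in> strands r s y" "cmod (u - W z) \<le> \<delta>"
  shows "total y u = d z y u"
proof -
  have "piece z' y u = 0" if z': "z' \<in> strands r s y" "z' \<noteq> z" for z'
  proof -
    have "4 * \<delta> \<le> cmod (W z' - W z)" using separated[OF assms(1) z'(1) assms(2) z'(2)] .
    also have "\<dots> \<le> cmod (u - W z) + cmod (u - W z')"
      using norm_triangle_ineq4[of "u - W z" "u - W z'"] by simp
    finally have "2 * \<delta> \<le> cmod (u - W z')" using assms(3) delta by linarith
    then show ?thesis using bump_simps(2)[OF delta] by (simp add: piece_def)
  qed
  then have "total y u = piece z y u"
    unfolding total_def using strands_finite_card(1)[OF s assms(1)] assms(2)
    by (subst sum.remove[of _ z]) auto
  then show ?thesis using bump_simps(1)[OF delta assms(3)] by (simp add: piece_def)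
qed

lemma total_bij: "cmod y = 1 \<Longrightarrow> bij (\<lambda>u. u + total y u)"
  by (rule bij_identity_plus_contraction[of _ "1 / 2"]) (use total_lipschitz in auto)

lemma total_isotopy:
  assumes "\<And>y. cmod y = 1 \<Longrightarrow> A y \<subseteq> ball 0 1"
  shows "ambient_isotopic S3 (fibred A) (fibred (\<lambda>y. (\<lambda>u. u + total y u) ` A y))"
proof (rule fibrewise_isotopy[where \<rho> = "1 - \<delta>", OF _ total_lipschitz])
  have "continuous_on (sphere 0 1 \<times> sphere 0 1 \<times> UNIV) (\<lambda>p. W (fst p))"
    by (rule continuous_on_compose2[OF cont_W]) (auto intro!: continuous_intros)
  then have "continuous_on (sphere 0 1 \<times> sphere 0 1 \<times> UNIV) (\<lambda>(z, y, u). piece z y u)"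
    using cont_d unfolding piece_def bump_def split_beta
    by (intro continuous_intros) (use delta in auto)
  from continuous_on_sum_strands[OF s this]
  show "continuous_on (sphere 0 1 \<times> UNIV) (\<lambda>(y, u). total y u)" by (simp add: total_def)
next
  fix y u :: complex assume y: "cmod y = 1" and u: "1 - \<delta> \<le> cmod u"
  have "piece z y u = 0" if z: "z \<in> strands r s y" for z
  proof -
    have "cmod (W z) \<le> 1 - 3 * \<delta>" using inside norm_strand[OF s y z] by simp
    moreover have "cmod u \<le> cmod (W z) + cmod (u - W z)" by (rule norm_triangle_sub)
    ultimately have "2 * \<delta> \<le> cmod (u - W z)" using u by linarith
    then show ?thesis using bump_simps(2)[OF delta] by (simp add: piece_def)
  qed
  then show "total y u = 0" by (simp add: total_def)
qed (use delta assms in auto)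

end

lemma braid_step:
  assumes s: "0 < s" and delta: "0 < \<delta>"
    and cont: "continuous_on (sphere 0 1) W" "continuous_on (sphere 0 1) W'"
    and inside: "\<And>z. cmod z = 1 \<Longrightarrow> cmod (W z) \<le> 1 - 3 * \<delta>"
    and separated: "\<And>y z z'. cmod y = 1 \<Longrightarrow> z \<in> strands r s y \<Longrightarrow> z' \<in> strands r s y \<Longrightarrow> z \<noteq> z' \<Longrightarrow>
        4 * \<delta> \<le> cmod (W z - W z')"
    and close: "\<And>z. cmod z = 1 \<Longrightarrow> cmod (W' z - W z) \<le> \<delta> / (4 * s)"
  shows "ambient_isotopic S3 (braid r s W) (braid r s W')"
proof -
  define d where "d z y u = W' z - W z" for z y u :: complex
  interpret strand_displacement r s \<delta> W d
  proof
    have "continuous_on (sphere 0 1 \<times> sphere 0 1 \<times> UNIV) (\<lambda>p. W (fst p))"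
      "continuous_on (sphere 0 1 \<times> sphere 0 1 \<times> UNIV) (\<lambda>p. W' (fst p))"
      by (rule continuous_on_compose2[OF cont(1)] continuous_on_compose2[OF cont(2)],
          auto intro!: continuous_intros)+
    then show "continuous_on (sphere 0 1 \<times> sphere 0 1 \<times> UNIV) (\<lambda>(z, y, u). d z y u)"
      unfolding d_def split_beta by (intro continuous_intros)
    show "cmod (d z y u) \<le> \<delta> / (4 * s)" if "cmod y = 1" "z \<in> strands r s y" for y z u
      using close norm_strand[OF s that] by (simp add: d_def)
  qed (use assms in \<open>auto simp: d_def\<close>)
  have "cmod (W z) < 1" if "cmod y = 1" "z \<in> strands r s y" for y z
    using inside[OF norm_strand[OF s that]] delta by linarith
  then have "ambient_isotopic S3 (fibred (\<lambda>y. W ` strands r s y))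
     (fibred (\<lambda>y. (\<lambda>u. u + total y u) ` (W ` strands r s y)))"
    by (intro total_isotopy) auto
  moreover have "fibred (\<lambda>y. (\<lambda>u. u + total y u) ` (W ` strands r s y)) = fibred (\<lambda>y. W' ` strands r s y)"
  proof (rule fibred_cong)
    fix y :: complex assume "cmod y = 1"
    then show "(\<lambda>u. u + total y u) ` (W ` strands r s y) = W' ` strands r s y"
      unfolding image_image
      by (intro image_cong) (use total_near[of y] delta in \<open>auto simp: d_def\<close>)
  qed
  ultimately show ?thesis unfolding braid_def by (simp only:)
qed

lemma compact_positive_lower_bound:
  fixes f :: "'a::topological_space \<Rightarrow> real"
  assumes "compact S" "continuous_on S f" "\<And>x. x \<in> S \<Longrightarrow> 0 < f x"
  shows "\<exists>\<delta>>0. \<forall>x\<in>S. \<delta> \<le> f x"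
proof (cases "S = {}")
  case False
  from continuous_attains_inf[OF assms(1) False assms(2)] assms(3) show ?thesis by blast
qed (auto intro: exI[of _ 1])

lemma strand_ratio:
  assumes "0 < s" "cmod y = 1" "z \<in> strands r s y" "z' \<in> strands r s y"
  shows "\<exists>\<zeta>. \<zeta> ^ s = 1 \<and> z' = \<zeta> * z"
proof -
  have "z \<noteq> 0" using norm_strand[OF assms(1-3)] by auto
  then show ?thesis using strands_eq_image(1)[of z s y r] assms(3,4) by (auto simp: strands_def)
qed

text \<open>Strands that stay apart from each other throughout a homotopy stay uniformly apart, so
  that the homotopy can be cut into steps that are small compared with their distance.\<close>

lemma braid_homotopy:
  fixes w :: "real \<Rightarrow> complex \<Rightarrow> complex"
  assumes s: "0 < s"
    and cont: "continuous_on ({0..1} \<times> sphere 0 1) (\<lambda>(t, z). w t z)"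
    and inside: "\<And>t z. t \<in> {0..1} \<Longrightarrow> cmod z = 1 \<Longrightarrow> cmod (w t z) < 1"
    and inj: "\<And>t z z'. t \<in> {0..1} \<Longrightarrow> cmod z = 1 \<Longrightarrow> cmod z' = 1 \<Longrightarrow> z ^ s = z' ^ s \<Longrightarrow>
        w t z = w t z' \<Longrightarrow> z = z'"
  shows "ambient_isotopic S3 (braid r s (w 0)) (braid r s (w 1))"
proof -
  let ?X = "{0..1} \<times> sphere 0 1 :: (real \<times> complex) set"
  let ?Z = "{\<zeta>::complex. \<zeta> ^ s = 1} - {1}"
  have X: "compact ?X" by (intro compact_Times) auto
  have fin: "finite {\<zeta>::complex. \<zeta> ^ s = 1}"
    using s by (intro card_ge_0_finite) (simp add: card_roots_unity_eq)
  have n1: "cmod \<zeta> = 1" if "\<zeta> ^ s = 1" for \<zeta>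
    using power_eq_1_iff[OF that] s by auto
  have cont': "continuous_on ?X (\<lambda>p. w (fst p) (snd p))" using cont by (simp add: split_beta)
  have c1: "continuous_on ?X (\<lambda>p. 1 - cmod (w (fst p) (snd p)))"
    by (intro continuous_intros cont')
  have p1: "0 < 1 - cmod (w (fst p) (snd p))" if "p \<in> ?X" for p
    using inside that by auto
  from compact_positive_lower_bound[OF X c1 p1] obtain \<delta>1 where
    d1: "0 < \<delta>1" "\<forall>p\<in>?X. \<delta>1 \<le> 1 - cmod (w (fst p) (snd p))" by metis
  have Y: "compact (?X \<times> ?Z)" by (intro compact_Times X finite_imp_compact finite_Diff fin)
  have cY: "continuous_on (?X \<times> ?Z) (\<lambda>q. w (fst (fst q)) (snd (fst q)))"
    by (rule continuous_on_compose2[OF cont', of _ fst]) (auto intro!: continuous_intros)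
  have cY': "continuous_on (?X \<times> ?Z) (\<lambda>q. w (fst (fst q)) (snd q * snd (fst q)))"
  proof -
    have c: "continuous_on (?X \<times> ?Z) (\<lambda>q. (fst (fst q), snd q * snd (fst q)))"
      by (intro continuous_intros)
    have "(\<lambda>q. (fst (fst q), snd q * snd (fst q))) ` (?X \<times> ?Z) \<subseteq> ?X"
      using n1 by (auto simp: norm_mult)
    from continuous_on_compose2[OF cont' c this] show ?thesis by simp
  qed
  define gap where
    "gap q = cmod (w (fst (fst q)) (snd (fst q)) - w (fst (fst q)) (snd q * snd (fst q)))"
    for q :: "(real \<times> complex) \<times> complex"
  have cgap: "continuous_on (?X \<times> ?Z) gap"
    unfolding gap_def by (intro continuous_intros cY cY')
  have pgap: "0 < gap q" if "q \<in> ?X \<times> ?Z" for q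
  proof -
    obtain t z \<zeta> where q: "q = ((t, z), \<zeta>)" by (metis surj_pair)
    with that have tz: "t \<in> {0..1}" "cmod z = 1" "\<zeta> ^ s = 1" "\<zeta> \<noteq> 1" by auto
    have "w t z \<noteq> w t (\<zeta> * z)"
    proof
      assume e: "w t z = w t (\<zeta> * z)"
      have "cmod (\<zeta> * z) = 1" "z ^ s = (\<zeta> * z) ^ s"
        using tz n1[OF tz(3)] by (simp_all add: power_mult_distrib norm_mult)
      from inj[OF tz(1,2) this e] have "z = \<zeta> * z" .
      moreover have "z \<noteq> 0" using tz by auto
      ultimately show False using tz by simp
    qed
    then show ?thesis by (simp add: q gap_def)
  qed
  from compact_positive_lower_bound[OF Y cgap pgap] obtain \<delta>2 where
    d2: "0 < \<delta>2" "\<forall>q\<in>?X \<times> ?Z. \<delta>2 \<le> gap q" by metis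
  define \<delta> where "\<delta> = min (\<delta>1 / 3) (\<delta>2 / 4)"
  have delta: "0 < \<delta>" "3 * \<delta> \<le> \<delta>1" "4 * \<delta> \<le> \<delta>2" using d1(1) d2(1) by (auto simp: \<delta>_def)
  have uc: "uniformly_continuous_on ?X (\<lambda>p. w (fst p) (snd p))"
    by (rule compact_uniformly_continuous[OF cont' X])
  have "0 < \<delta> / (4 * s)" using delta s by simp
  then obtain \<eta> where eta: "0 < \<eta>"
    "\<And>p q. p \<in> ?X \<Longrightarrow> q \<in> ?X \<Longrightarrow> dist q p < \<eta> \<Longrightarrow> dist (w (fst q) (snd q)) (w (fst p) (snd p)) < \<delta> / (4 * s)"
    using uniformly_continuous_onE[OF uc] by metis
  have ct: "continuous_on (sphere 0 1) (w t)" if "t \<in> {0..1}" for t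
  proof -
    have c: "continuous_on (sphere 0 1) (\<lambda>z::complex. (t, z))" by (intro continuous_intros)
    have "(\<lambda>z. (t, z)) ` sphere 0 1 \<subseteq> ?X" using that by blast
    from continuous_on_compose2[OF cont' c this] show ?thesis by simp
  qed
  have step: "ambient_isotopic S3 (braid r s (w t)) (braid r s (w t'))"
    if t: "t \<in> {0..1}" "t' \<in> {0..1}" "\<bar>t - t'\<bar> < \<eta>" for t t'
  proof (rule braid_step[OF s delta(1) ct[OF t(1)] ct[OF t(2)]])
    fix z :: complex assume z: "cmod z = 1"
    show "cmod (w t z) \<le> 1 - 3 * \<delta>" using bspec[OF d1(2), of "(t, z)"] delta t z by auto
    have "dist (w t' z) (w t z) < \<delta> / (4 * s)"
      using eta(2)[of "(t, z)" "(t', z)"] t z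
      by (auto simp: dist_Pair_Pair dist_real_def abs_minus_commute)
    then show "cmod (w t' z - w t z) \<le> \<delta> / (4 * s)" by (simp add: dist_norm)
  next
    fix y z z' assume *: "cmod y = 1" "z \<in> strands r s y" "z' \<in> strands r s y" "z \<noteq> z'"
    obtain \<zeta> where "\<zeta> ^ s = 1" "z' = \<zeta> * z" using strand_ratio[OF s *(1-3)] by blast
    then show "4 * \<delta> \<le> cmod (w t z - w t z')"
      using bspec[OF d2(2), of "((t, z), \<zeta>)"] delta t * norm_strand[OF s *(1,2)] by (auto simp: gap_def)
  qed
  obtain n :: nat where n: "0 < n" "1 / n < \<eta>"
    using eta(1) by (metis nat_approx_posE of_nat_Suc zero_less_Suc)
  have "ambient_isotopic S3 (braid r s (w 0)) (braid r s (w (real i / n)))" if "i \<le> n" for i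
    using that
  proof (induction i)
    case 0
    have "braid r s (w 0) \<subseteq> S3"
      using step[of 0 0] eta(1) by (simp add: ambient_isotopic_def)
    then show ?case by (simp add: ambient_isotopic_refl)
  next
    case (Suc i)
    have "real i / n - real (Suc i) / n = - (1 / n)" using n by (simp add: field_simps)
    then have "\<bar>real i / n - real (Suc i) / n\<bar> < \<eta>" using n by simp
    then have "ambient_isotopic S3 (braid r s (w (real i / n))) (braid r s (w (real (Suc i) / n)))"
      using Suc.prems n by (intro step) auto
    then show ?case using Suc ambient_isotopic_trans Suc_leD by blast
  qed
  from this[of n] n show ?thesis by simp
qed

section \<open>Laurent forms and lemniscates\<close>

text \<open>What replaces \<open>e\<^sup>i\<^sup>k\<^sup>h\<close> in the definition of \<open>f\<^sub>\<lambda>\<close>.\<close>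

definition half_conj_power :: "complex \<Rightarrow> int \<Rightarrow> complex" where
  "half_conj_power v k = (if 0 \<le> k then v ^ nat k else cnj v ^ nat \<bar>k\<bar>)"

lemma lemn_f_eq: "lemn_f a b s r l lam (u, v) = subst_poly (half_conj_power v) (laurent_form a b s r l lam) u"
  by (simp add: lemn_f_def half_conj_power_def[abs_def])

lemma subst_poly_expand:
  assumes "degree P \<le> n"
  shows "subst_poly \<phi> P u = (\<Sum>m\<le>n. subst_laurent \<phi> (coeff P m) * u ^ m)"
proof -
  have "degree (map_poly (subst_laurent \<phi>) P) \<le> n"
    using assms by (intro degree_le) (simp add: coeff_map_poly coeff_eq_0)
  then have d: "{..degree (map_poly (subst_laurent \<phi>) P)} \<subseteq> {..n}" by simp
  have "poly (map_poly (subst_laurent \<phi>) P) u = (\<Sum>m\<le>n. coeff (map_poly (subst_laurent \<phi>) P) m * u ^ m)"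
    unfolding poly_altdef
    by (rule sum.mono_neutral_left[OF _ d]) (auto simp: coeff_eq_0)
  then show ?thesis by (simp add: subst_poly_def coeff_map_poly)
qed

lemma subst_laurent_scale:
  "subst_laurent \<phi> (Poly_Mapping.single 0 x * c) = x * subst_laurent \<phi> c"
proof -
  have "Poly_Mapping.single 0 x * c =
      (\<Sum>k\<in>Poly_Mapping.keys c. Poly_Mapping.single k (x * Poly_Mapping.lookup c k))"
    by (subst laurent_decomp[of c]) (simp add: sum_distrib_left mult_single)
  then show ?thesis
    by (simp add: subst_laurent_sum sum_distrib_left mult.assoc) (simp add: subst_laurent_def sum_distrib_left mult.assoc)
qed

lemma lemn_Z_scale: "lemn_Z a b s r l lam j h = of_real lam * lemn_Z a b s r l 1 j h"
  by (simp add: lemn_Z_def)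

lemma lemn_p_scale:
  "lemn_p a b s r l lam (of_real lam * u) h = of_real lam ^ s * lemn_p a b s r l 1 u h"
proof -
  have "lemn_p a b s r l lam (of_real lam * u) h
      = (\<Prod>j = 1..s. of_real lam * (u - lemn_Z a b s r l 1 j h))"
    unfolding lemn_p_def by (subst lemn_Z_scale) (simp add: right_diff_distrib)
  then show ?thesis by (simp add: lemn_p_def prod.distrib)
qed

text \<open>For each \<open>h\<close> the specialization at \<open>e\<^sup>i\<^sup>h\<close> is a product of \<open>s\<close> monic linear factors, and a Laurent
  polynomial is determined by its values on an arc of the unit circle.\<close>

lemma laurent_form_monic:
  assumes "0 < s" "0 < l"
  shows "degree (laurent_form a b s r l lam) \<le> s"
    and "coeff (laurent_form a b s r l lam) s = Poly_Mapping.single 0 1"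
proof -
  let ?P = "laurent_form a b s r l lam"
  have co: "subst_laurent (\<lambda>k. cis (of_int k * h)) (coeff ?P m) =
      coeff (\<Prod>j = 1..s. [:- lemn_Z a b s r l lam j h, 1:]) m"
    if "h \<in> {0..1}" for h m
  proof -
    have "h \<in> {0..2*pi}" using that pi_gt3 by auto
    then have "poly (map_poly (subst_laurent (\<lambda>k. cis (of_int k * h))) ?P) u =
        poly (\<Prod>j = 1..s. [:- lemn_Z a b s r l lam j h, 1:]) u" for u
      using laurent_form_represents[OF assms, of a b r lam]
      by (simp add: represents_p_def subst_poly_def lemn_p_def poly_prod)
    then have "map_poly (subst_laurent (\<lambda>k. cis (of_int k * h))) ?P =
        (\<Prod>j = 1..s. [:- lemn_Z a b s r l lam j h, 1:])"
      by (intro poly_ext)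
    then show ?thesis by (metis coeff_map_poly subst_laurent_0)
  qed
  have deg: "degree (\<Prod>j = 1..s. [:- lemn_Z a b s r l lam j h, 1:]) = s" for h
    by (subst degree_prod_eq_sum_degree) auto
  have lead: "lead_coeff (\<Prod>j = 1..s. [:- lemn_Z a b s r l lam j h, 1:]) = 1" for h
    by (simp add: lead_coeff_prod)
  have inf: "infinite {0..1::real}" by (simp add: infinite_Icc_iff)
  show "degree ?P \<le> s"
  proof (rule degree_le, intro allI impI)
    fix m assume "s < m"
    then have "coeff (\<Prod>j = 1..s. [:- lemn_Z a b s r l lam j h, 1:]) m = 0" for h
      by (intro coeff_eq_0) (simp only: deg)
    then show "coeff ?P m = 0"
      by (intro laurent_zero[OF inf inj_cis]) (simp only: co)
  qed
  have "coeff ?P s - Poly_Mapping.single 0 1 = 0"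
  proof (rule laurent_zero[OF inf inj_cis])
    fix h :: real assume "h \<in> {0..1}"
    from co[OF this, of s] lead[of h, unfolded deg]
    show "subst_laurent (\<lambda>k. cis (of_int k * h)) (coeff ?P s - Poly_Mapping.single 0 1) = 0"
      by (simp add: subst_laurent_diff del: single_one)
  qed
  then show "coeff ?P s = Poly_Mapping.single 0 1" by simp
qed

text \<open>Scaling \<open>u\<close> and \<open>\<lambda>\<close> simultaneously multiplies \<open>p\<^sub>\<lambda>\<close> by a constant; as the Laurent form
  is unique, the same holds after the substitution of \<open>v\<close> and its conjugate.\<close>

lemma lemn_f_scale:
  assumes "0 < s" "0 < l" "lam \<noteq> 0"
  shows "lemn_f a b s r l lam (of_real lam * u, v) = of_real lam ^ s * lemn_f a b s r l 1 (u, v)"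
proof -
  let ?P = "laurent_form a b s r l 1"
  define Q where "Q = (\<Sum>m\<le>s. monom (Poly_Mapping.single 0 (of_real lam ^ (s - m)) * coeff ?P m) m)"
  have coQ: "coeff Q m = (if m \<le> s then Poly_Mapping.single 0 (of_real lam ^ (s - m)) * coeff ?P m else 0)" for m
    by (simp add: Q_def coeff_sum)
  have degQ: "degree Q \<le> s" by (rule degree_le) (simp add: coQ)
  have Q: "subst_poly \<phi> Q (of_real lam * u) = of_real lam ^ s * subst_poly \<phi> ?P u" for \<phi> u
  proof -
    have "subst_poly \<phi> Q (of_real lam * u) =
        (\<Sum>m\<le>s. of_real lam ^ (s - m) * subst_laurent \<phi> (coeff ?P m) * (of_real lam * u) ^ m)"
      by (simp add: subst_poly_expand[OF degQ] coQ subst_laurent_scale)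
    also have "\<dots> = (\<Sum>m\<le>s. of_real lam ^ s * (subst_laurent \<phi> (coeff ?P m) * u ^ m))"
    proof (rule sum.cong)
      fix m assume "m \<in> {..s}"
      then have "of_real lam ^ s = (of_real lam ^ (s - m) * of_real lam ^ m :: complex)"
        by (simp flip: power_add)
      then show "of_real lam ^ (s - m) * subst_laurent \<phi> (coeff ?P m) * (of_real lam * u) ^ m =
          of_real lam ^ s * (subst_laurent \<phi> (coeff ?P m) * u ^ m)"
        by (simp add: power_mult_distrib)
    qed simp
    also have "\<dots> = of_real lam ^ s * subst_poly \<phi> ?P u"
      by (simp add: subst_poly_expand[OF laurent_form_monic(1)[OF assms(1,2)]] sum_distrib_left)
    finally show ?thesis .
  qed
  have "represents_p a b s r l lam Q"
    unfolding represents_p_def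
  proof (intro allI ballI)
    fix u :: complex and h :: real assume h: "h \<in> {0..2*pi}"
    have u: "u = of_real lam * (u / of_real lam)" using assms(3) by simp
    have "subst_poly (\<lambda>k. cis (of_int k * h)) Q u =
        of_real lam ^ s * subst_poly (\<lambda>k. cis (of_int k * h)) ?P (u / of_real lam)"
      by (subst u) (rule Q)
    also have "\<dots> = of_real lam ^ s * lemn_p a b s r l 1 (u / of_real lam) h"
      using laurent_form_represents[OF assms(1,2), of a b r 1] h by (simp add: represents_p_def)
    also have "\<dots> = lemn_p a b s r l lam u h"
      by (subst (2) u) (rule lemn_p_scale[symmetric])
    finally show "subst_poly (\<lambda>k. cis (of_int k * h)) Q u = lemn_p a b s r l lam u h" .
  qed
  then have "laurent_form a b s r l lam = Q"
    using laurent_form_represents[OF assms(1,2)] represents_p_unique by blast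
  then show ?thesis by (simp add: lemn_f_eq Q)
qed

text \<open>The shape of the polynomial used below: leading term \<open>u\<^sup>s\<close>, and lower coefficients that are finite
  combinations of the substituted powers of \<open>v\<close>.\<close>

lemma lemn_f_expansion:
  assumes "0 < s" "0 < l"
  shows "\<exists>K c. finite K \<and> (\<forall>u v. lemn_f a b s r l 1 (u, v) =
      u ^ s + (\<Sum>m<s. \<Sum>k\<in>K. c m k * half_conj_power v k * u ^ m))"
proof -
  let ?P = "laurent_form a b s r l 1"
  define K where "K = (\<Union>m<s. Poly_Mapping.keys (coeff ?P m))"
  have finK: "finite K" by (simp add: K_def)
  have K: "Poly_Mapping.keys (coeff ?P m) \<subseteq> K" if "m < s" for m using that by (auto simp: K_def)
  have "lemn_f a b s r l 1 (u, v) =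
      u ^ s + (\<Sum>m<s. \<Sum>k\<in>K. Poly_Mapping.lookup (coeff ?P m) k * half_conj_power v k * u ^ m)" for u v
  proof -
    have "lemn_f a b s r l 1 (u, v) =
        (\<Sum>m\<le>s. subst_laurent (half_conj_power v) (coeff ?P m) * u ^ m)"
      unfolding lemn_f_eq by (rule subst_poly_expand[OF laurent_form_monic(1)[OF assms]])
    also have "\<dots> = subst_laurent (half_conj_power v) (coeff ?P s) * u ^ s
        + (\<Sum>m<s. subst_laurent (half_conj_power v) (coeff ?P m) * u ^ m)"
      by (simp add: add.commute flip: lessThan_Suc_atMost)
    also have "subst_laurent (half_conj_power v) (coeff ?P s) = 1"
      by (simp add: laurent_form_monic(2)[OF assms] half_conj_power_def del: single_one)
    also have "(\<Sum>m<s. subst_laurent (half_conj_power v) (coeff ?P m) * u ^ m) =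
        (\<Sum>m<s. \<Sum>k\<in>K. Poly_Mapping.lookup (coeff ?P m) k * half_conj_power v k * u ^ m)"
      by (intro sum.cong refl) (simp add: subst_laurent_superset[OF finK K] sum_distrib_right)
    finally show ?thesis by (simp only: mult_1_left)
  qed
  with finK show ?thesis
    by (intro exI[of _ K] exI[of _ "\<lambda>m. Poly_Mapping.lookup (coeff ?P m)"] conjI allI)
qed

text \<open>The curve whose parametrization by \<open>(rh + 2\<pi>(j - 1)) / s\<close> gives the strands, as a function on
  the unit circle.\<close>

definition lemniscate :: "real \<Rightarrow> real \<Rightarrow> nat \<Rightarrow> complex \<Rightarrow> complex" where
  "lemniscate a b l z = of_real (a * Re z) + \<i> * of_real (b / l * Im (z ^ l))"

lemma lemn_Z_eq_lemniscate:
  "lemn_Z a b s r l lam j h =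
     of_real lam * lemniscate a b l (cis ((real r * h + 2 * pi * (real j - 1)) / real s))"
  by (simp add: lemn_Z_def lemniscate_def Complex.DeMoivre)

lemma bij_betw_strands:
  assumes "0 < s"
  shows "bij_betw (\<lambda>j. cis ((real r * h + 2 * pi * (real j - 1)) / real s)) {1..s} (strands r s (cis h))"
proof -
  let ?z = "cis (r * h / s)"
  have z: "?z ^ s = cis h ^ r" "?z \<noteq> 0" using assms by (simp_all add: Complex.DeMoivre)
  have 1: "bij_betw (\<lambda>j::nat. j - 1) {1..s} {..<s}"
    by (rule bij_betwI[of _ _ _ Suc]) auto
  have 2: "bij_betw (\<lambda>\<zeta>. \<zeta> * ?z) {\<zeta>. \<zeta> ^ s = 1} (strands r s (cis h))"
    unfolding bij_betw_def using strands_eq_image[OF z] by simp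
  have "bij_betw ((\<lambda>\<zeta>. \<zeta> * ?z) \<circ> ((\<lambda>k. cis (2 * pi * real k / real s)) \<circ> (\<lambda>j. j - 1)))
      {1..s} (strands r s (cis h))"
    by (rule bij_betw_trans[OF bij_betw_trans[OF 1 Complex.bij_betw_roots_unity[OF assms]] 2])
  then show ?thesis
    by (rule bij_betw_cong[THEN iffD1, rotated])
       (simp add: cis_mult add_divide_distrib of_nat_diff add.commute)
qed

lemma lemn_p_eq_prod_strands:
  assumes "0 < s"
  shows "lemn_p a b s r l 1 u h = (\<Prod>z\<in>strands r s (cis h). u - lemniscate a b l z)"
  using prod.reindex_bij_betw[OF bij_betw_strands[OF assms], of "\<lambda>z. u - lemniscate a b l z"]
  unfolding lemn_p_def lemn_Z_eq_lemniscate of_real_1 mult_1_left .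

lemma half_conj_power_cis: "half_conj_power (cis h) k = cis (of_int k * h)"
  by (simp add: half_conj_power_def cis_cnj Complex.DeMoivre)

text \<open>For \<open>|v| = 1\<close> the substitution is undone: \<open>v\<close> and its conjugate are \<open>e\<^sup>i\<^sup>h\<close> and \<open>e\<^sup>-\<^sup>i\<^sup>h\<close>.\<close>

lemma lemn_f_unit_circle:
  assumes "0 < s" "0 < l" "cmod y = 1"
  shows "lemn_f a b s r l 1 (u, y) = (\<Prod>z\<in>strands r s y. u - lemniscate a b l z)"
proof -
  have "y \<noteq> 0" using assms by auto
  then have y: "y = cis (Arg2pi y)"
    using assms(3) Arg2pi_eq[of y] by (simp add: cis_conv_exp)
  have "Arg2pi y \<in> {0..2*pi}" using Arg2pi_ge_0 Arg2pi_lt_2pi[of y] by (simp add: less_imp_le)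
  then have "lemn_f a b s r l 1 (u, y) = lemn_p a b s r l 1 u (Arg2pi y)"
    using laurent_form_represents[OF assms(1,2), of a b r 1]
    by (subst y) (simp add: lemn_f_eq half_conj_power_cis[abs_def] represents_p_def)
  then show ?thesis using lemn_p_eq_prod_strands[OF assms(1)] y by metis
qed

lemma root_of_unity_coprime:
  fixes x :: "'a::field"
  assumes "x ^ m = 1" "x ^ n = 1" "coprime m n"
  shows "x = 1"
proof (cases "m = 0")
  case False
  obtain p q where "m * p = n * q + 1"
    using bezout_nat[OF False, of n] assms(3) by (auto simp: coprime_iff_gcd_eq_1)
  then have "x ^ (m * p) = x ^ (n * q) * x" by simp
  then show ?thesis using assms(1,2) by (simp add: power_mult)
qed (use assms in auto)

text \<open>If two points of the circle have the same image then their real parts agree, so they are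
  equal or complex conjugate.  In the second case the \<open>l\<close>-th powers are conjugate with equal
  imaginary parts, hence equal; as the points lie over the same base point, their ratio is also
  an \<open>s\<close>-th root of unity.\<close>

lemma lemniscate_inj:
  assumes "0 < a" "0 < b" "0 < l" "coprime s l"
    and "cmod z = 1" "cmod z' = 1" "z ^ s = z' ^ s"
    and eq: "lemniscate a b l z = lemniscate a b l z'"
  shows "z = z'"
proof -
  have "Re (lemniscate a b l z) = Re (lemniscate a b l z')" using eq by simp
  then have re: "Re z = Re z'" using assms(1) by (simp add: lemniscate_def)
  have "Im (lemniscate a b l z) = Im (lemniscate a b l z')" using eq by simp
  then have im: "Im (z ^ l) = Im (z' ^ l)" using assms(2,3) by (simp add: lemniscate_def)
  have "(Im z)\<^sup>2 = (Im z')\<^sup>2"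
    using assms(5,6) re cmod_power2[of z] cmod_power2[of z'] by simp
  then consider "Im z' = Im z" | "Im z' = - Im z" by (metis power2_eq_iff)
  then show ?thesis
  proof cases
    case 2
    then have "z' = cnj z" using re by (simp add: complex_eq_iff)
    then have "z' ^ l = cnj (z ^ l)" by simp
    then have "Re (z' ^ l) = Re (z ^ l)" by (simp del: complex_cnj_power)
    then have "z ^ l = z' ^ l" using im by (simp add: complex_eq_iff)
    then have "(z / z') ^ l = 1" "(z / z') ^ s = 1"
      using assms(6,7) by (auto simp: power_divide)
    then have "z / z' = 1" using root_of_unity_coprime assms(4) by blast
    then show ?thesis by simp
  qed (use re in \<open>simp add: complex_eq_iff\<close>)
qed

section \<open>The zero set is a small perturbation of a closed braid\<close>

lemma half_conj_power_scale:
  assumes "0 \<le> \<rho>"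
  shows "half_conj_power (of_real \<rho> * y) k = of_real (\<rho> ^ nat \<bar>k\<bar>) * half_conj_power y k"
  by (simp add: half_conj_power_def power_mult_distrib)

lemma norm_half_conj_power: "cmod (half_conj_power v k) = cmod v ^ nat \<bar>k\<bar>"
  by (simp add: half_conj_power_def norm_power)

lemma continuous_on_half_conj_power [continuous_intros]:
  "continuous_on S f \<Longrightarrow> continuous_on S (\<lambda>x. half_conj_power (f x) k)"
  unfolding half_conj_power_def by (cases "0 \<le> k") (auto intro!: continuous_intros)

lemma norm_power_diff_bounded:
  fixes w w' :: complex
  assumes "1 \<le> M" "cmod w \<le> M" "cmod w' \<le> M"
  shows "cmod (w ^ m - w' ^ m) \<le> real m * M ^ m * cmod (w - w')"
proof -
  have "cmod ((w / M) ^ m - (w' / M) ^ m) \<le> m * cmod (w / M - w' / M)"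
    using assms by (intro norm_power_diff) (auto simp: norm_divide)
  then have "cmod (w ^ m - w' ^ m) / M ^ m \<le> m * (cmod (w - w') / M)"
    using assms(1) by (simp add: power_divide norm_divide norm_power flip: diff_divide_distrib)
  also have "\<dots> \<le> m * cmod (w - w')"
    using assms(1) by (intro mult_left_mono) (auto simp: divide_le_eq mult_le_cancel_left1)
  finally show ?thesis using assms(1) by (simp add: divide_le_eq mult_ac)
qed

lemma norm_prod_diff_bounded:
  fixes f g :: "'a \<Rightarrow> complex" and B e :: real
  assumes "1 \<le> B" "\<And>i. i \<in> I \<Longrightarrow> cmod (f i) \<le> B" "\<And>i. i \<in> I \<Longrightarrow> cmod (g i) \<le> B"
    and "\<And>i. i \<in> I \<Longrightarrow> cmod (f i - g i) \<le> e"
  shows "cmod ((\<Prod>i\<in>I. f i) - (\<Prod>i\<in>I. g i)) \<le> card I * B ^ card I * e"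
proof (cases "I = {} \<or> infinite I")
  case False
  have "cmod ((\<Prod>i\<in>I. f i / B) - (\<Prod>i\<in>I. g i / B)) \<le> (\<Sum>i\<in>I. cmod (f i / B - g i / B))"
    using assms by (intro norm_prod_diff) (auto simp: norm_divide)
  also have "\<dots> \<le> (\<Sum>i\<in>I. e)"
  proof (rule sum_mono)
    fix i assume i: "i \<in> I"
    have "cmod (f i / B - g i / B) = cmod (f i - g i) / B"
      using assms(1) by (simp add: norm_divide flip: diff_divide_distrib)
    also have "\<dots> \<le> cmod (f i - g i)" using assms(1) by (simp add: divide_le_eq mult_le_cancel_left1)
    finally show "cmod (f i / B - g i / B) \<le> e" using assms(4)[OF i] by linarith
  qed
  also have "(\<Prod>i\<in>I. f i / B) - (\<Prod>i\<in>I. g i / B) = ((\<Prod>i\<in>I. f i) - (\<Prod>i\<in>I. g i)) / B ^ card I"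
    by (simp add: prod_dividef diff_divide_distrib)
  finally show ?thesis using assms(1) by (simp add: norm_divide norm_power divide_le_eq mult_ac)
qed auto

lemma sphere_height_lipschitz:
  assumes "0 \<le> lam" "0 \<le> M" "lam * M \<le> 1 / 2" "cmod w \<le> M" "cmod w' \<le> M"
  shows "\<bar>sqrt (1 - (lam * cmod w)\<^sup>2) - sqrt (1 - (lam * cmod w')\<^sup>2)\<bar> \<le> 2 * M * lam\<^sup>2 * cmod (w - w')"
proof -
  define p where "p w = sqrt (1 - (lam * cmod w)\<^sup>2)" for w
  have half: "1 / 2 \<le> p w" and sq: "(p w)\<^sup>2 = 1 - (lam * cmod w)\<^sup>2" if "cmod w \<le> M" for w
  proof -
    have "lam * cmod w \<le> 1 / 2" using mult_left_mono[OF that assms(1)] assms(3) by linarith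
    then have "(lam * cmod w)\<^sup>2 \<le> (1 / 2)\<^sup>2" using assms(1) by (intro power_mono) auto
    then have *: "(1 / 2)\<^sup>2 \<le> 1 - (lam * cmod w)\<^sup>2" by (simp add: power2_eq_square)
    then show "1 / 2 \<le> p w" unfolding p_def by (rule real_le_rsqrt)
    have "0 \<le> 1 - (lam * cmod w)\<^sup>2" using * by (simp add: power2_eq_square)
    then show "(p w)\<^sup>2 = 1 - (lam * cmod w)\<^sup>2" by (simp add: p_def)
  qed
  have "\<bar>p w - p w'\<bar> * 1 \<le> \<bar>p w - p w'\<bar> * (p w + p w')"
    using half[OF assms(4)] half[OF assms(5)] by (intro mult_left_mono) auto
  also have "\<dots> = \<bar>(p w - p w') * (p w + p w')\<bar>"
    using half[OF assms(4)] half[OF assms(5)] by (simp add: abs_mult)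
  also have "(p w - p w') * (p w + p w') = (p w)\<^sup>2 - (p w')\<^sup>2"
    by (simp add: power2_eq_square algebra_simps)
  also have "\<dots> = lam\<^sup>2 * ((cmod w' - cmod w) * (cmod w' + cmod w))"
    using sq[OF assms(4)] sq[OF assms(5)] by (simp add: power2_eq_square algebra_simps)
  also have "\<bar>\<dots>\<bar> = lam\<^sup>2 * (\<bar>cmod w' - cmod w\<bar> * (cmod w' + cmod w))"
    by (simp add: abs_mult)
  also have "\<dots> \<le> lam\<^sup>2 * (cmod (w - w') * (2 * M))"
    using norm_triangle_ineq3[of w' w] assms(2,4,5)
    by (intro mult_left_mono mult_mono) (auto simp: norm_minus_commute)
  finally show ?thesis by (simp add: p_def mult_ac)
qed

lemma radial_defect_monomial:
  assumes "0 \<le> lam" "1 \<le> M" "lam * M \<le> 1 / 2" "cmod w \<le> M" "cmod w' \<le> M"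
  defines "\<rho> \<equiv> \<lambda>w. sqrt (1 - (lam * cmod w)\<^sup>2)"
  shows "cmod ((of_real (\<rho> w ^ n) - 1) * w ^ m - (of_real (\<rho> w' ^ n) - 1) * w' ^ m)
    \<le> (2 * real n * M ^ (m + 1) + 2 * real n * M\<^sup>2 * real m * M ^ m) * lam\<^sup>2 * cmod (w - w')"
proof -
  have rho: "\<bar>\<rho> w\<bar> \<le> 1" if "cmod w \<le> M" for w
  proof -
    have "lam * cmod w \<le> 1 / 2" using mult_left_mono[OF that assms(1)] assms(3) by linarith
    then have "(lam * cmod w)\<^sup>2 \<le> 1" using assms(1) by (intro power_le_one) auto
    then show ?thesis by (simp add: \<rho>_def)
  qed
  have pow: "\<bar>\<rho> w ^ n - \<rho> w' ^ n\<bar> \<le> n * (2 * M * lam\<^sup>2 * cmod (w - w'))"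
    if "cmod w \<le> M" "cmod w' \<le> M" for w w'
  proof -
    have "\<bar>\<rho> w ^ n - \<rho> w' ^ n\<bar> \<le> n * \<bar>\<rho> w - \<rho> w'\<bar>"
      using norm_power_diff[of "\<rho> w" "\<rho> w'" n] rho[OF that(1)] rho[OF that(2)] by simp
    also have "\<dots> \<le> n * (2 * M * lam\<^sup>2 * cmod (w - w'))"
      unfolding \<rho>_def using assms that by (intro mult_left_mono sphere_height_lipschitz) auto
    finally show ?thesis .
  qed
  have pow1: "\<bar>\<rho> w' ^ n - 1\<bar> \<le> n * (2 * M * lam\<^sup>2 * M)"
  proof -
    have "\<bar>\<rho> w' ^ n - \<rho> 0 ^ n\<bar> \<le> n * (2 * M * lam\<^sup>2 * cmod (w' - 0))"
      using pow[OF assms(5), of 0] assms(2) by simp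
    also have "\<dots> \<le> n * (2 * M * lam\<^sup>2 * M)"
      using assms(2,5) by (intro mult_left_mono) auto
    finally show ?thesis by (simp add: \<rho>_def)
  qed
  have e: "(of_real (\<rho> w ^ n) - 1) * w ^ m - (of_real (\<rho> w' ^ n) - 1) * w' ^ m =
      of_real (\<rho> w ^ n - \<rho> w' ^ n) * w ^ m + of_real (\<rho> w' ^ n - 1) * (w ^ m - w' ^ m)"
    by (simp add: algebra_simps)
  have "cmod ((of_real (\<rho> w ^ n) - 1) * w ^ m - (of_real (\<rho> w' ^ n) - 1) * w' ^ m)
      \<le> \<bar>\<rho> w ^ n - \<rho> w' ^ n\<bar> * cmod w ^ m + \<bar>\<rho> w' ^ n - 1\<bar> * cmod (w ^ m - w' ^ m)"
    unfolding e by (rule norm_triangle_le) (simp only: norm_mult norm_of_real norm_power order_refl)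
  also have "\<dots> \<le> (n * (2 * M * lam\<^sup>2 * cmod (w - w'))) * M ^ m
      + (n * (2 * M * lam\<^sup>2 * M)) * (m * M ^ m * cmod (w - w'))"
  proof (intro add_mono mult_mono)
    show "cmod (w ^ m - w' ^ m) \<le> m * M ^ m * cmod (w - w')"
      by (rule norm_power_diff_bounded[OF assms(2,4,5)])
  qed (use pow[OF assms(4,5)] pow1 assms in \<open>auto intro!: power_mono mult_nonneg_nonneg\<close>)
  also have "\<dots> = (2 * real n * M ^ (m + 1) + 2 * real n * M\<^sup>2 * real m * M ^ m) * lam\<^sup>2 * cmod (w - w')"
    by (simp add: power2_eq_square algebra_simps)
  finally show ?thesis .
qed

text \<open>The part of degree less than \<open>s\<close> of a polynomial that is monic in \<open>u\<close>.\<close>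

definition lower_terms ::
  "nat \<Rightarrow> int set \<Rightarrow> (nat \<Rightarrow> int \<Rightarrow> complex) \<Rightarrow> complex \<Rightarrow> complex \<Rightarrow> complex" where
  "lower_terms s K c v u = (\<Sum>m<s. \<Sum>k\<in>K. c m k * half_conj_power v k * u ^ m)"

text \<open>On the three-sphere \<open>v\<close> has modulus \<open>sqrt (1 - (\<lambda> |w|)^2)\<close> at \<open>u = \<lambda> w\<close> instead of \<open>1\<close>.  The effect of
  this on the equation is of second order in \<open>\<lambda>\<close>, also with respect to Lipschitz constants.\<close>

lemma radial_defect:
  assumes "finite K" "1 \<le> M"
  shows "\<exists>C\<ge>0. \<forall>lam y w w'. 0 \<le> lam \<longrightarrow> lam * M \<le> 1 / 2 \<longrightarrow> cmod y = 1 \<longrightarrow> cmod w \<le> M \<longrightarrow> cmod w' \<le> M \<longrightarrow>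
    cmod ((lower_terms s K c (of_real (sqrt (1 - (lam * cmod w)\<^sup>2)) * y) w - lower_terms s K c y w) -
          (lower_terms s K c (of_real (sqrt (1 - (lam * cmod w')\<^sup>2)) * y) w' - lower_terms s K c y w'))
      \<le> C * lam\<^sup>2 * cmod (w - w')"
proof -
  define C0 where "C0 m k = 2 * real (nat \<bar>k\<bar>) * M ^ (m + 1) + 2 * real (nat \<bar>k\<bar>) * M\<^sup>2 * real m * M ^ m" for m :: nat and k :: int
  define C where "C = (\<Sum>m<s. \<Sum>k\<in>K. cmod (c m k) * C0 m k)"
  have C0: "0 \<le> C0 m k" for m k using assms(2) by (simp add: C0_def)
  have "0 \<le> C" unfolding C_def using C0 by (intro sum_nonneg mult_nonneg_nonneg) auto
  moreover have "cmod ((lower_terms s K c (of_real (sqrt (1 - (lam * cmod w)\<^sup>2)) * y) w - lower_terms s K c y w) -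
          (lower_terms s K c (of_real (sqrt (1 - (lam * cmod w')\<^sup>2)) * y) w' - lower_terms s K c y w'))
      \<le> C * lam\<^sup>2 * cmod (w - w')"
    if lam: "0 \<le> lam" "lam * M \<le> 1 / 2" and y: "cmod y = 1" and w: "cmod w \<le> M" "cmod w' \<le> M" for lam y w w'
  proof -
    define \<rho> where "\<rho> w = sqrt (1 - (lam * cmod w)\<^sup>2)" for w
    have rho: "0 \<le> \<rho> w" if "cmod w \<le> M" for w
    proof -
      have "lam * cmod w \<le> 1 / 2" using mult_left_mono[OF that lam(1)] lam(2) by linarith
      then have "(lam * cmod w)\<^sup>2 \<le> 1" using lam(1) by (intro power_le_one) auto
      then show ?thesis by (simp add: \<rho>_def)
    qed
    define T where "T m k w = c m k * half_conj_power y k * ((of_real (\<rho> w ^ nat \<bar>k\<bar>) - 1) * w ^ m)" for m k w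
    have low: "lower_terms s K c (of_real (\<rho> w) * y) w - lower_terms s K c y w = (\<Sum>m<s. \<Sum>k\<in>K. T m k w)"
      if "cmod w \<le> M" for w
      unfolding lower_terms_def sum_subtractf[symmetric]
      by (intro sum.cong refl)
         (simp only: half_conj_power_scale[OF rho[OF that]] T_def, simp add: algebra_simps)
    have T: "cmod (T m k w - T m k w') \<le> cmod (c m k) * C0 m k * (lam\<^sup>2 * cmod (w - w'))" for m k
    proof -
      have "T m k w - T m k w' = c m k * half_conj_power y k *
          ((of_real (\<rho> w ^ nat \<bar>k\<bar>) - 1) * w ^ m - (of_real (\<rho> w' ^ nat \<bar>k\<bar>) - 1) * w' ^ m)"
        by (simp only: T_def right_diff_distrib)
      then have "cmod (T m k w - T m k w') = cmod (c m k) *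
          cmod ((of_real (\<rho> w ^ nat \<bar>k\<bar>) - 1) * w ^ m - (of_real (\<rho> w' ^ nat \<bar>k\<bar>) - 1) * w' ^ m)"
        by (simp only: norm_mult norm_half_conj_power y power_one mult_1_right)
      also have "\<dots> \<le> cmod (c m k) * (C0 m k * lam\<^sup>2 * cmod (w - w'))"
        unfolding C0_def \<rho>_def using lam assms w by (intro mult_left_mono radial_defect_monomial) auto
      finally show ?thesis by (simp only: mult.assoc)
    qed
    have "cmod ((\<Sum>m<s. \<Sum>k\<in>K. T m k w) - (\<Sum>m<s. \<Sum>k\<in>K. T m k w'))
        \<le> (\<Sum>m<s. \<Sum>k\<in>K. cmod (c m k) * C0 m k * (lam\<^sup>2 * cmod (w - w')))"
      unfolding sum_subtractf[symmetric] using T by (intro sum_norm_le order_trans[OF norm_sum] sum_mono)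
    also have "\<dots> = C * lam\<^sup>2 * cmod (w - w')"
      by (simp add: C_def sum_distrib_right mult.assoc)
    finally show ?thesis using low[OF w(1)] low[OF w(2)] by (simp add: \<rho>_def)
  qed
  ultimately show ?thesis by (intro exI[of _ C] conjI allI impI)
qed

text \<open>The bound holds for all \<open>v\<close> in the closed unit disc at once; it confines the zeros on the sphere
  before anything is known about \<open>|v|\<close>.\<close>

lemma monic_root_bound:
  assumes "0 < s" "finite K" "cmod v \<le> 1" "u ^ s + lower_terms s K c v u = 0"
  shows "cmod u \<le> 1 + (\<Sum>m<s. \<Sum>k\<in>K. cmod (c m k))"
proof (rule ccontr)
  let ?C = "\<Sum>m<s. \<Sum>k\<in>K. cmod (c m k)"
  assume "\<not> ?thesis"
  then have u: "1 + ?C < cmod u" by simp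
  have C: "0 \<le> ?C" by (intro sum_nonneg) auto
  have "u ^ s = - lower_terms s K c v u" using assms(4) by (simp add: add_eq_0_iff)
  then have "cmod u ^ s = cmod (lower_terms s K c v u)" by (metis norm_minus_cancel norm_power)
  also have "\<dots> \<le> (\<Sum>m<s. \<Sum>k\<in>K. cmod (c m k) * cmod u ^ (s - 1))"
    unfolding lower_terms_def
  proof (intro sum_norm_le)
    fix m k assume m: "m \<in> {..<s}"
    have "cmod (c m k * half_conj_power v k * u ^ m) = cmod (c m k) * (cmod v ^ nat \<bar>k\<bar> * cmod u ^ m)"
      by (simp add: norm_mult norm_half_conj_power norm_power)
    also have "\<dots> \<le> cmod (c m k) * (1 * cmod u ^ (s - 1))"
      using m u C assms(3) by (intro mult_left_mono mult_mono power_le_one power_increasing) auto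
    finally show "cmod (c m k * half_conj_power v k * u ^ m) \<le> cmod (c m k) * cmod u ^ (s - 1)" by simp
  qed
  also have "\<dots> = ?C * cmod u ^ (s - 1)" by (simp add: sum_distrib_right)
  also have "\<dots> < cmod u * cmod u ^ (s - 1)"
  proof (rule mult_strict_right_mono)
    have "0 < cmod u" using u C by linarith
    then show "0 < cmod u ^ (s - 1)" by (rule zero_less_power)
  qed (use u in linarith)
  also have "\<dots> = cmod u ^ s" using assms(1) by (simp flip: power_Suc)
  finally show False by simp
qed

text \<open>Near the strand through \<open>Z z\<close> the displacement is a Newton-like step: with the value \<open>Q z\<close> of the
  derivative at the strand, \<open>w + d\<close> equals \<open>Z z\<close> plus the value of the equation divided by \<open>Q z\<close>, so that
  exactly the solutions are moved to the strand.  In the model case of \<open>v\<close> of modulus one the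
  equation is a product of linear factors, whence \<open>d\<close> is of second order at the strand.\<close>

theorem zero_set_isotopic_braid:
  fixes g :: "complex \<Rightarrow> complex \<Rightarrow> complex"
  assumes s: "0 < s" and K: "finite K"
    and g: "\<And>u v. g u v = u ^ s + lower_terms s K c v u"
    and unit: "\<And>u y. cmod y = 1 \<Longrightarrow> g u y = (\<Prod>z\<in>strands r s y. u - Z z)"
    and contZ: "continuous_on (sphere 0 1) Z"
    and injZ: "\<And>z z'. cmod z = 1 \<Longrightarrow> cmod z' = 1 \<Longrightarrow> z ^ s = z' ^ s \<Longrightarrow> Z z = Z z' \<Longrightarrow> z = z'"
  shows "\<exists>\<epsilon>>0. \<forall>lam. 0 < lam \<and> lam < \<epsilon> \<longrightarrow>
    ambient_isotopic S3 {p \<in> S3. g (fst p / of_real lam) (snd p) = 0} (braid r s (\<lambda>z. of_real lam * Z z))"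
proof -
  let ?U = "{\<zeta>::complex. \<zeta> ^ s = 1} - {1}"
  have finU: "finite {\<zeta>::complex. \<zeta> ^ s = 1}"
    using s by (intro card_ge_0_finite) (simp add: card_roots_unity_eq)
  have n1: "cmod \<zeta> = 1" if "\<zeta> ^ s = 1" for \<zeta> using power_eq_1_iff[OF that] s by auto
  have contZ': "continuous_on (sphere 0 1) (\<lambda>z. Z (\<zeta> * z))" if "\<zeta> ^ s = 1" for \<zeta>
    by (rule continuous_on_compose2[OF contZ])
       (use n1[OF that] in \<open>auto intro!: continuous_intros simp: norm_mult\<close>)
  \<comment> \<open>The product over the other strands of the fibre: they are the multiples of \<open>z\<close> by the roots of
    unity different from \<open>1\<close>.\<close>
  define q where "q z u = (\<Prod>\<zeta>\<in>?U. u - Z (\<zeta> * z))" for z u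
  define Q where "Q z = q z (Z z)" for z
  have neq: "Z z \<noteq> Z (\<zeta> * z)" if "cmod z = 1" "\<zeta> \<in> ?U" for z \<zeta>
  proof
    assume e: "Z z = Z (\<zeta> * z)"
    have "cmod (\<zeta> * z) = 1" "z ^ s = (\<zeta> * z) ^ s"
      using that n1[of \<zeta>] by (simp_all add: norm_mult power_mult_distrib)
    from injZ[OF that(1) this e] have "z = \<zeta> * z" .
    moreover have "z \<noteq> 0" using that by auto
    ultimately show False using that by simp
  qed
  have contQ: "continuous_on (sphere 0 1) Q"
    unfolding Q_def q_def by (intro continuous_intros contZ contZ') auto
  have Q0: "Q z \<noteq> 0" if "cmod z = 1" for z
    unfolding Q_def q_def using neq[OF that] finU by (simp add: prod_zero_iff)
  have factor: "g u y = (u - Z z) * q z u" if "cmod y = 1" "z \<in> strands r s y" for u y z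
  proof -
    have z: "z ^ s = y ^ r" "z \<noteq> 0" using that norm_strand[OF s that] by (auto simp: strands_def)
    have "g u y = (\<Prod>\<zeta> | \<zeta> ^ s = 1. u - Z (\<zeta> * z))"
      by (simp add: unit[OF that(1)] strands_eq_image(1)[OF z] prod.reindex[OF strands_eq_image(2)[OF z]])
    then show ?thesis unfolding q_def using finU by (subst (asm) prod.remove[of _ 1]) auto
  qed
  obtain B where B: "\<And>z. cmod z = 1 \<Longrightarrow> cmod (Z z) \<le> B"
  proof -
    have "bounded (Z ` sphere 0 1)"
      by (intro compact_imp_bounded compact_continuous_image contZ) simp
    then obtain B where "\<forall>x\<in>Z ` sphere 0 1. cmod x \<le> B" unfolding bounded_iff by blast
    then show ?thesis by (intro that[of B]) auto
  qed
  \<comment> \<open>The radius of a disc in the \<open>w\<close>-plane that contains all zeros and, with a margin, all strands.\<close>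
  define M where "M = max (1 + (\<Sum>m<s. \<Sum>k\<in>K. cmod (c m k))) (B + 1)"
  have "0 \<le> (\<Sum>m<s. \<Sum>k\<in>K. cmod (c m k))" by (intro sum_nonneg) auto
  then have M1: "1 \<le> M" by (simp add: M_def)
  have MB: "cmod (Z z) + 1 \<le> M" if "cmod z = 1" for z using B[OF that] by (simp add: M_def)
  have root_M: "cmod u \<le> M" if "g u v = 0" "cmod v \<le> 1" for u v
    using monic_root_bound[OF s K that(2)] that(1) unfolding g M_def by fastforce
  obtain C where C: "0 \<le> C" and defect: "\<And>lam y w w'. 0 \<le> lam \<Longrightarrow> lam * M \<le> 1 / 2 \<Longrightarrow> cmod y = 1 \<Longrightarrow>
      cmod w \<le> M \<Longrightarrow> cmod w' \<le> M \<Longrightarrow>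
      cmod ((lower_terms s K c (of_real (sqrt (1 - (lam * cmod w)\<^sup>2)) * y) w - lower_terms s K c y w) -
          (lower_terms s K c (of_real (sqrt (1 - (lam * cmod w')\<^sup>2)) * y) w' - lower_terms s K c y w'))
      \<le> C * lam\<^sup>2 * cmod (w - w')"
    using radial_defect[OF K M1, of s c] by metis
  have sph: "compact (sphere (0::complex) 1)" by simp
  have "\<exists>c0>0. \<forall>z\<in>sphere 0 1. c0 \<le> cmod (Q z)"
    by (rule compact_positive_lower_bound[OF sph]) (use contQ Q0 in \<open>auto intro!: continuous_intros\<close>)
  then obtain c0 where c0: "0 < c0" "\<And>z. cmod z = 1 \<Longrightarrow> c0 \<le> cmod (Q z)" by auto
  define Lq where "Lq = card ?U * (2 * M) ^ card ?U + 1"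
  have Lq1: "0 < Lq" using M1 by (simp add: Lq_def add_nonneg_pos)
  have Lq: "cmod (q z u - q z u') \<le> Lq * cmod (u - u')"
    if "cmod z = 1" "cmod u \<le> M" "cmod u' \<le> M" for z u u'
  proof -
    have ZM: "cmod (Z (\<zeta> * z)) \<le> M" if "\<zeta> \<in> ?U" for \<zeta>
      using MB[of "\<zeta> * z"] n1[of \<zeta>] that \<open>cmod z = 1\<close> by (simp add: norm_mult)
    have "cmod (q z u - q z u') \<le> card ?U * (2 * M) ^ card ?U * cmod (u - u')"
      unfolding q_def
    proof (rule norm_prod_diff_bounded)
      fix \<zeta> assume z: "\<zeta> \<in> ?U"
      show "cmod (u - Z (\<zeta> * z)) \<le> 2 * M" "cmod (u' - Z (\<zeta> * z)) \<le> 2 * M"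
        using ZM[OF z] that(2,3) norm_triangle_ineq4[of u "Z (\<zeta> * z)"] norm_triangle_ineq4[of u' "Z (\<zeta> * z)"]
        by linarith+
    qed (use M1 in auto)
    also have "\<dots> \<le> Lq * cmod (u - u')" unfolding Lq_def by (intro mult_right_mono) auto
    finally show ?thesis .
  qed
  have "\<exists>\<delta>>0. \<forall>z\<in>sphere 0 1. \<delta> \<le> cmod (Z z - Z (\<zeta> * z))" if "\<zeta> \<in> ?U" for \<zeta>
    by (rule compact_positive_lower_bound[OF sph])
       (use that neq contZ contZ'[of \<zeta>] in \<open>auto intro!: continuous_intros\<close>)
  then obtain gap where gap: "\<And>\<zeta>. \<zeta> \<in> ?U \<Longrightarrow> 0 < gap \<zeta>"
    "\<And>\<zeta> z. \<zeta> \<in> ?U \<Longrightarrow> cmod z = 1 \<Longrightarrow> gap \<zeta> \<le> cmod (Z z - Z (\<zeta> * z))"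
    by (metis mem_sphere_0)
  define gap0 where "gap0 = Min (insert 1 (gap ` ?U))"
  have gap0: "0 < gap0" "\<And>\<zeta>. \<zeta> \<in> ?U \<Longrightarrow> gap0 \<le> gap \<zeta>"
    unfolding gap0_def using gap(1) finU by (auto simp: Min_le_iff)
  \<comment> \<open>The second-order part of \<open>d\<close> has Lipschitz constant \<open>4\<delta> Lq / c0\<close> on discs of radius \<open>2\<delta>\<close>; this
    has to be a small fraction of \<open>1 / s\<close>, as \<open>s\<close> displacements are added.\<close>
  define \<delta> where "\<delta> = min (1 / 2) (min (gap0 / 4) (c0 / (128 * s * Lq)))"
  have delta: "0 < \<delta>" "\<delta> \<le> 1 / 2" "4 * \<delta> \<le> gap0" "4 * \<delta> * Lq / c0 \<le> 1 / (32 * s)"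
  proof -
    show "0 < \<delta>" "\<delta> \<le> 1 / 2" "4 * \<delta> \<le> gap0" using gap0(1) c0(1) Lq1 s by (auto simp: \<delta>_def)
    have "\<delta> \<le> c0 / (128 * s * Lq)" by (simp add: \<delta>_def)
    then have "\<delta> * (128 * s * Lq) \<le> c0" using Lq1 s by (simp add: pos_le_divide_eq)
    then show "4 * \<delta> * Lq / c0 \<le> 1 / (32 * s)" using c0(1) s by (simp add: field_simps)
  qed
  have sep: "4 * \<delta> \<le> cmod (Z z - Z z')"
    if yz: "cmod y = 1" "z \<in> strands r s y" "z' \<in> strands r s y" "z \<noteq> z'" for y z z'
  proof -
    obtain \<zeta> where z: "\<zeta> ^ s = 1" "z' = \<zeta> * z" using strand_ratio[OF s yz(1-3)] by blast
    then have zU: "\<zeta> \<in> ?U" using yz(4) by auto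
    from gap(2)[OF zU norm_strand[OF s yz(1,2)]] gap0(2)[OF zU] delta(3)
    show ?thesis unfolding z(2) by linarith
  qed
  \<comment> \<open>Bounds for the error \<open>C \<lambda>\<^sup>2\<close>: for its Lipschitz constant and its size after division by \<open>Q\<close>, and
    for the localization of the zeros, at which the product of the distances to the \<open>s\<close> strands
    must be less than \<open>\<delta>\<^sup>s\<close>.\<close>
  define \<eta> where "\<eta> = min (c0 / (32 * s)) (min (c0 * \<delta> / (8 * s * M)) (\<delta> ^ s / (2 * M)))"
  have eta: "0 < \<eta>" "\<eta> / c0 \<le> 1 / (32 * s)" "\<eta> * M / c0 \<le> \<delta> / (8 * s)" "\<eta> * M < \<delta> ^ s"
  proof -
    show "0 < \<eta>" using c0(1) s delta(1) M1 by (simp add: \<eta>_def)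
    have "\<eta> \<le> c0 / (32 * s)" by (simp add: \<eta>_def)
    then show "\<eta> / c0 \<le> 1 / (32 * s)" using c0(1) s by (simp add: field_simps)
    have "\<eta> \<le> c0 * \<delta> / (8 * s * M)" by (simp add: \<eta>_def)
    then show "\<eta> * M / c0 \<le> \<delta> / (8 * s)" using c0(1) s M1 by (simp add: field_simps)
    have "\<eta> \<le> \<delta> ^ s / (2 * M)" by (simp add: \<eta>_def)
    then have "\<eta> * M \<le> \<delta> ^ s / 2" using M1 by (simp add: field_simps)
    moreover have "0 < \<delta> ^ s" using delta(1) by simp
    ultimately show "\<eta> * M < \<delta> ^ s" by linarith
  qed
  define \<epsilon> where "\<epsilon> = min (1 / (2 * M)) (\<eta> / (C + 1))"
  have "0 < \<epsilon>" using M1 eta(1) C by (simp add: \<epsilon>_def)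
  moreover have "ambient_isotopic S3 {p \<in> S3. g (fst p / of_real lam) (snd p) = 0} (braid r s (\<lambda>z. of_real lam * Z z))"
    if lam: "0 < lam" "lam < \<epsilon>" for lam
  proof -
    have lamM: "lam * M \<le> 1 / 2"
    proof -
      have "lam \<le> 1 / (2 * M)" using lam by (simp add: \<epsilon>_def)
      then show ?thesis using M1 by (simp add: field_simps)
    qed
    then have lam1: "lam \<le> 1 / 2" using M1 lam(1) mult_left_mono[of 1 M lam] by linarith
    have Ceta: "C * lam\<^sup>2 \<le> \<eta>"
    proof -
      have "lam\<^sup>2 \<le> 1 * lam" unfolding power2_eq_square using lam(1) lam1 by (intro mult_right_mono) auto
      then have "C * lam\<^sup>2 \<le> C * lam" using C by (intro mult_left_mono) auto
      also have "\<dots> \<le> (C + 1) * lam" using lam(1) by simp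
      also have "\<dots> \<le> (C + 1) * (\<eta> / (C + 1))"
        using lam(2) C by (intro mult_left_mono) (auto simp: \<epsilon>_def)
      also have "\<dots> = \<eta>" using C by simp
      finally show ?thesis .
    qed
    define G where "G y w = g w (of_real (sqrt (1 - (lam * cmod w)\<^sup>2)) * y)" for y w
    define E where "E y w = G y w - g w y" for y w
    have E: "cmod (E y w - E y w') \<le> \<eta> * cmod (w - w')"
      if "cmod y = 1" "cmod w \<le> M" "cmod w' \<le> M" for y w w'
    proof -
      have "cmod (E y w - E y w') \<le> C * lam\<^sup>2 * cmod (w - w')"
        using defect[OF _ lamM that] lam(1) by (simp add: E_def G_def g)
      also have "\<dots> \<le> \<eta> * cmod (w - w')" using Ceta by (intro mult_right_mono) auto
      finally show ?thesis .
    qed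
    have E0: "cmod (E y w) \<le> \<eta> * M" if "cmod y = 1" "cmod w \<le> M" for y w
    proof -
      have "cmod (E y w) \<le> \<eta> * cmod w" using E[OF that, of 0] M1 by (simp add: E_def G_def)
      also have "\<dots> \<le> \<eta> * M" using that eta(1) by (intro mult_left_mono) auto
      finally show ?thesis .
    qed
    define d where "d z y w = G y w / Q z - (w - Z z)" for z y w
    have ZM: "cmod w \<le> M" if "cmod z = 1" "cmod (w - Z z) \<le> 2 * \<delta>" for w z
      using MB[OF that(1)] that(2) delta(2) norm_triangle_sub[of w "Z z"] by linarith
    have dlip: "cmod (d z y w - d z y w') \<le> cmod (w - w') / (16 * s)"
      if y: "cmod y = 1" and z: "z \<in> strands r s y"
        and w: "cmod (w - Z z) \<le> 2 * \<delta>" "cmod (w' - Z z) \<le> 2 * \<delta>" for z y w w'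
    proof -
      have z1: "cmod z = 1" by (rule norm_strand[OF s y z])
      note wM = ZM[OF z1 w(1)] ZM[OF z1 w(2)]
      have zM: "cmod (Z z) \<le> M" using MB[OF z1] by simp
      have dd: "d z y x = (E y x + (x - Z z) * (q z x - Q z)) / Q z" for x
        using Q0[OF z1] by (simp add: d_def E_def factor[OF y z] field_simps)
      have "d z y w - d z y w' =
          (E y w - E y w' + ((w - w') * (q z w - Q z) + (w' - Z z) * (q z w - q z w'))) / Q z"
        unfolding dd using Q0[OF z1] by (simp add: field_simps)
      also have "cmod \<dots> \<le> (\<eta> * cmod (w - w') + (cmod (w - w') * (Lq * (2 * \<delta>)) + 2 * \<delta> * (Lq * cmod (w - w')))) / c0"
        unfolding norm_divide
      proof (rule frac_le)
        have 1: "cmod (q z w - Q z) \<le> Lq * (2 * \<delta>)"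
        proof -
          have "cmod (q z w - Q z) \<le> Lq * cmod (w - Z z)" unfolding Q_def by (rule Lq[OF z1 wM(1) zM])
          also have "\<dots> \<le> Lq * (2 * \<delta>)" using Lq1 w by (intro mult_left_mono) auto
          finally show ?thesis .
        qed
        have 2: "cmod (q z w - q z w') \<le> Lq * cmod (w - w')" by (rule Lq[OF z1 wM])
        have "cmod ((w - w') * (q z w - Q z)) \<le> cmod (w - w') * (Lq * (2 * \<delta>))"
          unfolding norm_mult using 1 by (intro mult_left_mono) auto
        moreover have "cmod ((w' - Z z) * (q z w - q z w')) \<le> 2 * \<delta> * (Lq * cmod (w - w'))"
          unfolding norm_mult using 2 w delta(1) by (intro mult_mono) auto
        ultimately show "cmod (E y w - E y w' + ((w - w') * (q z w - Q z) + (w' - Z z) * (q z w - q z w')))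
            \<le> \<eta> * cmod (w - w') + (cmod (w - w') * (Lq * (2 * \<delta>)) + 2 * \<delta> * (Lq * cmod (w - w')))"
          using E[OF y wM] by (intro norm_triangle_mono)
        show "0 \<le> \<eta> * cmod (w - w') + (cmod (w - w') * (Lq * (2 * \<delta>)) + 2 * \<delta> * (Lq * cmod (w - w')))"
          using eta(1) Lq1 delta(1) by simp
      qed (use c0 z1 in auto)
      also have "\<dots> = (\<eta> / c0 + 4 * \<delta> * Lq / c0) * cmod (w - w')"
        using c0(1) by (simp add: field_simps)
      also have "\<dots> \<le> (1 / (32 * s) + 1 / (32 * s)) * cmod (w - w')"
        using eta(2) delta(4) by (intro mult_right_mono add_mono) auto
      also have "\<dots> = cmod (w - w') / (16 * s)" by (simp add: field_simps)
      finally show ?thesis .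
    qed
    have dsmall: "cmod (d z y w) \<le> \<delta> / (4 * s)"
      if y: "cmod y = 1" and z: "z \<in> strands r s y" and w: "cmod (w - Z z) \<le> 2 * \<delta>" for z y w
    proof -
      have z1: "cmod z = 1" by (rule norm_strand[OF s y z])
      have "d z y (Z z) = E y (Z z) / Q z"
        using factor[OF y z, of "Z z"] by (simp add: d_def E_def)
      then have "cmod (d z y (Z z)) \<le> \<eta> * M / c0"
        unfolding norm_divide using E0[OF y, of "Z z"] MB[OF z1] c0 z1 eta(1) M1
        by (auto simp: norm_divide intro!: frac_le)
      then have "cmod (d z y (Z z)) \<le> \<delta> / (8 * s)" using eta(3) by linarith
      moreover have "cmod (d z y w - d z y (Z z)) \<le> \<delta> / (8 * s)"
      proof -
        have "cmod (d z y w - d z y (Z z)) \<le> cmod (w - Z z) / (16 * s)"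
          using dlip[OF y z w, of "Z z"] delta(1) by simp
        also have "\<dots> \<le> 2 * \<delta> / (16 * s)" using w by (intro divide_right_mono) auto
        finally show ?thesis by simp
      qed
      moreover have "cmod (d z y w) \<le> cmod (d z y (Z z)) + cmod (d z y w - d z y (Z z))"
        by (rule norm_triangle_sub)
      moreover have "\<delta> / (8 * s) + \<delta> / (8 * s) = \<delta> / (4 * s)" by simp
      ultimately show ?thesis by linarith
    qed
    have scale: "cmod (u - of_real lam * Z z) = lam * cmod (u / of_real lam - Z z)" for u z
    proof -
      have "u - of_real lam * Z z = of_real lam * (u / of_real lam - Z z)"
        using lam(1) by (simp add: field_simps)
      then show ?thesis using lam(1) by (simp add: norm_mult)
    qed
    define W where "W z = of_real lam * Z z" for z
    define d' where "d' z y u = of_real lam * d z y (u / of_real lam)" for z y u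
    interpret D: strand_displacement r s "lam * \<delta>" W d'
    proof
      show "0 < s" "0 < lam * \<delta>" using s lam delta by auto
      show "continuous_on (sphere 0 1) W" unfolding W_def by (intro continuous_intros contZ)
      have cZ: "continuous_on (sphere 0 1 \<times> sphere 0 1 \<times> UNIV) (\<lambda>p. Z (fst p))"
        by (rule continuous_on_compose2[OF contZ]) (auto intro!: continuous_intros)
      have cQ: "continuous_on (sphere 0 1 \<times> sphere 0 1 \<times> UNIV) (\<lambda>p. Q (fst p))"
        by (rule continuous_on_compose2[OF contQ]) (auto intro!: continuous_intros)
      show "continuous_on (sphere 0 1 \<times> sphere 0 1 \<times> UNIV) (\<lambda>(z, y, u). d' z y u)"
        unfolding d'_def d_def G_def g lower_terms_def split_beta
        by (intro continuous_intros cZ cQ) (use Q0 lam(1) in auto)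
      show "cmod (W z) \<le> 1 - 3 * (lam * \<delta>)" if "cmod z = 1" for z
      proof -
        have "cmod (W z) \<le> lam * (M - 1)"
          unfolding W_def norm_mult using lam(1) MB[OF that] by (auto intro!: mult_left_mono)
        moreover have "lam * (M - 1) = lam * M - lam" by (simp add: algebra_simps)
        moreover have "lam * \<delta> \<le> lam * (1 / 2)"
          using lam(1) delta(2) by (intro mult_left_mono) auto
        ultimately show ?thesis using lamM lam1 lam(1) by linarith
      qed
      show "4 * (lam * \<delta>) \<le> cmod (W z - W z')"
        if "cmod y = 1" "z \<in> strands r s y" "z' \<in> strands r s y" "z \<noteq> z'" for y z z'
      proof -
        have "lam * (4 * \<delta>) \<le> lam * cmod (Z z - Z z')"
          using sep[OF that] lam(1) by (intro mult_left_mono) auto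
        also have "\<dots> = cmod (W z - W z')"
          unfolding W_def right_diff_distrib[symmetric] norm_mult using lam(1) by simp
        finally show ?thesis by simp
      qed
      show "cmod (d' z y u) \<le> lam * \<delta> / (4 * s)"
        if "cmod y = 1" "z \<in> strands r s y" "cmod (u - W z) \<le> 2 * (lam * \<delta>)" for y z u
      proof -
        have "cmod (u / of_real lam - Z z) \<le> 2 * \<delta>"
          using that(3) lam(1) unfolding W_def scale by simp
        from dsmall[OF that(1,2) this] have "lam * cmod (d z y (u / of_real lam)) \<le> lam * (\<delta> / (4 * s))"
          using lam(1) by (intro mult_left_mono) auto
        then show ?thesis using lam(1) by (simp add: d'_def norm_mult)
      qed
      show "cmod (d' z y u - d' z y u') \<le> cmod (u - u') / (4 * s)"
        if "cmod y = 1" "z \<in> strands r s y" "cmod (u - W z) \<le> 2 * (lam * \<delta>)" "cmod (u' - W z) \<le> 2 * (lam * \<delta>)"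
        for y z u u'
      proof -
        have "cmod (u / of_real lam - Z z) \<le> 2 * \<delta>" "cmod (u' / of_real lam - Z z) \<le> 2 * \<delta>"
          using that(3,4) lam(1) unfolding W_def scale by simp_all
        from dlip[OF that(1,2) this]
        have "lam * cmod (d z y (u / of_real lam) - d z y (u' / of_real lam))
            \<le> lam * (cmod (u / of_real lam - u' / of_real lam) / (16 * s))"
          using lam(1) by (intro mult_left_mono) auto
        also have "\<dots> = cmod (u - u') / (16 * s)"
          using lam(1) by (simp add: norm_divide flip: diff_divide_distrib)
        also have "\<dots> \<le> cmod (u - u') / (4 * s)" using s by (intro divide_left_mono) auto
        finally show ?thesis
          unfolding d'_def right_diff_distrib[symmetric] norm_mult using lam(1) by simp
      qed
    qed
    define A where "A y = {u. cmod u < 1 \<and> g (u / of_real lam) (of_real (sqrt (1 - (cmod u)\<^sup>2)) * y) = 0}" for y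
    have GA: "G y (u / of_real lam) = g (u / of_real lam) (of_real (sqrt (1 - (cmod u)\<^sup>2)) * y)" for y u
      using lam(1) by (simp add: G_def norm_divide)
    have eqA: "{p \<in> S3. g (fst p / of_real lam) (snd p) = 0} = fibred A"
    proof (intro equalityI subsetI)
      fix p assume p: "p \<in> {p \<in> S3. g (fst p / of_real lam) (snd p) = 0}"
      obtain u v where uv: "p = (u, v)" by force
      have S: "(u, v) \<in> S3" and g0: "g (u / of_real lam) v = 0" using p by (auto simp: uv)
      have "(cmod u)\<^sup>2 + (cmod v)\<^sup>2 = 1" using S by (simp add: S3_def)
      then have "(cmod v)\<^sup>2 \<le> 1" using zero_le_power2[of "cmod u"] by linarith
      then have "cmod v \<le> 1" by (simp add: abs_square_le_1)
      then have "cmod (u / of_real lam) \<le> M" by (rule root_M[OF g0])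
      then have "cmod u \<le> lam * M" using lam(1) by (simp add: norm_divide field_simps)
      then have u1: "cmod u < 1" using lamM by linarith
      then have "(cmod u)\<^sup>2 < 1" by (simp add: abs_square_less_1)
      then have "v \<noteq> 0" using S by (auto simp: S3_def)
      then have v1: "cmod (sgn v) = 1" by (simp add: norm_sgn)
      have L: "lift u (sgn v) = (u, v)" by (rule lift_sgn_of_S3[OF S])
      then have "u \<in> A (sgn v)" using u1 g0 by (simp add: A_def lift_def)
      then show "p \<in> fibred A" unfolding fibred_def uv L[symmetric] using v1 by blast
    next
      fix p assume "p \<in> fibred A"
      then obtain u y where p: "p = lift u y" "cmod y = 1" "u \<in> A y" unfolding fibred_def by blast
      then have "p \<in> S3" using lift_in_S3[of u y] by (simp add: A_def)
      moreover have "g (fst p / of_real lam) (snd p) = 0" using p by (simp add: A_def lift_def)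
      ultimately show "p \<in> {p \<in> S3. g (fst p / of_real lam) (snd p) = 0}" by simp
    qed
    have img: "(\<lambda>u. u + D.total y u) ` A y = W ` strands r s y" if y: "cmod y = 1" for y
    proof (intro equalityI subsetI)
      fix x assume "x \<in> (\<lambda>u. u + D.total y u) ` A y"
      then obtain u where u: "u \<in> A y" "x = u + D.total y u" by auto
      define w where "w = u / of_real lam"
      have G0: "G y w = 0" using u(1) unfolding w_def GA by (simp add: A_def)
      have "cmod u < 1" using u(1) by (simp add: A_def)
      then have "(cmod u)\<^sup>2 \<le> 1" by (simp add: abs_square_le_1)
      then have "cmod (of_real (sqrt (1 - (cmod u)\<^sup>2)) * y) \<le> 1" by (simp add: norm_mult y)
      then have wM: "cmod w \<le> M" using root_M u(1) unfolding w_def A_def by auto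
      have "\<exists>z\<in>strands r s y. cmod (w - Z z) \<le> \<delta>"
      proof (rule ccontr)
        assume "\<not> ?thesis"
        then have "\<delta> ^ card (strands r s y) \<le> (\<Prod>z\<in>strands r s y. cmod (w - Z z))"
          unfolding prod_constant[symmetric] using delta(1) by (intro prod_mono) (auto simp: not_le)
        also have "\<dots> = cmod (E y w)"
          using G0 by (simp add: E_def unit[OF y] prod_norm)
        also have "\<dots> \<le> \<eta> * M" by (rule E0[OF y wM])
        finally show False using eta(4) strands_finite_card(2)[OF s y] by simp
      qed
      then obtain z where z: "z \<in> strands r s y" "cmod (w - Z z) \<le> \<delta>" by blast
      have "cmod (u - W z) \<le> lam * \<delta>"
        unfolding W_def scale using z(2) lam(1) by (simp add: w_def)
      from D.total_near[OF y z(1) this] have "x = u + of_real lam * (Z z - w)"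
        unfolding u(2) by (simp add: d'_def d_def G0 flip: w_def)
      then have "x = W z" using lam(1) by (simp add: w_def W_def right_diff_distrib)
      then show "x \<in> W ` strands r s y" using z(1) by blast
    next
      fix x assume "x \<in> W ` strands r s y"
      then obtain z where z: "z \<in> strands r s y" "x = W z" by blast
      have z1: "cmod z = 1" by (rule norm_strand[OF s y z(1)])
      have "surj (\<lambda>u. u + D.total y u)" by (rule bij_is_surj[OF D.total_bij[OF y]])
      from surjD[OF this, of "W z"] obtain u where u: "W z = u + D.total y u" by blast
      have "u - W z = - D.total y u" using u by (simp add: algebra_simps)
      then have near: "cmod (u - W z) \<le> lam * \<delta> / 4" using D.total_bound[OF y, of u] by simp
      have ld: "0 < lam * \<delta>" using lam delta by simp
      define w where "w = u / of_real lam"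
      have uw: "u = of_real lam * w" using lam(1) by (simp add: w_def)
      have "D.total y u = d' z y u" using near ld by (intro D.total_near[OF y z(1)]) linarith
      then have "D.total y u = of_real lam * d z y w" by (simp only: d'_def w_def)
      then have "of_real lam * Z z = of_real lam * (w + d z y w)"
        using u uw by (simp only: W_def distrib_left)
      then have "Z z = w + d z y w" using lam(1) by simp
      then have "G y w = 0" using Q0[OF z1] by (simp add: d_def)
      moreover have "cmod u < 1"
        using near ld D.inside[OF z1] norm_triangle_sub[of u "W z"] by linarith
      ultimately have "u \<in> A y" unfolding A_def using GA[of y u] by (simp add: w_def)
      then show "x \<in> (\<lambda>u. u + D.total y u) ` A y" using u z(2) by blast
    qed
    have "ambient_isotopic S3 (fibred A) (fibred (\<lambda>y. (\<lambda>u. u + D.total y u) ` A y))"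
      by (rule D.total_isotopy) (auto simp: A_def)
    also have "fibred (\<lambda>y. (\<lambda>u. u + D.total y u) ` A y) = braid r s W"
      unfolding braid_def by (rule fibred_cong) (rule img)
    finally show ?thesis unfolding eqA W_def .
  qed
  ultimately show ?thesis by blast
qed

section \<open>Closed braids over the circle are links\<close>

text \<open>A point of the closed braid determines its direction, and then its strand.\<close>

lemma lift_braid_inj:
  assumes "cmod y = 1" "cmod y' = 1" "cmod z = 1" "cmod z' = 1" "z ^ s = y ^ r" "z' ^ s = y' ^ r"
    and inside: "\<And>z. cmod z = 1 \<Longrightarrow> cmod (W z) < 1"
    and inj: "\<And>z z'. cmod z = 1 \<Longrightarrow> cmod z' = 1 \<Longrightarrow> z ^ s = z' ^ s \<Longrightarrow> W z = W z' \<Longrightarrow> z = z'"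
    and eq: "lift (W z) y = lift (W z') y'"
  shows "y = y'" "z = z'"
proof -
  show y: "y = y'"
    using sgn_lift(1)[OF inside[OF assms(3)] assms(1)] sgn_lift(1)[OF inside[OF assms(4)] assms(2)] eq
    by simp
  show "z = z'"
    by (rule inj) (use assms y in \<open>simp_all add: lift_def\<close>)
qed

text \<open>The exponents of \<open>t\<close> and \<open>y\<close> in the common root are Bezout coefficients of \<open>m\<close> and \<open>n\<close>.\<close>

lemma ex_common_root:
  fixes t y :: "'a::field"
  assumes "coprime m n" "0 < m" "t ^ n = y ^ m" "t \<noteq> 0" "y \<noteq> 0"
  shows "\<exists>x. x ^ m = t \<and> x ^ n = y"
proof -
  have "m \<noteq> 0" using assms(2) by simp
  from bezout_nat[OF this, of n] obtain p q where pq: "m * p = n * q + 1"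
    using assms(1) by (auto simp: coprime_iff_gcd_eq_1)
  define x where "x = t ^ p / y ^ q"
  have "x ^ m = t ^ (m * p) / y ^ (m * q)"
    by (simp add: x_def power_divide mult.commute flip: power_mult)
  also have "y ^ (m * q) = t ^ (n * q)" using assms(3) by (simp add: power_mult)
  also have "t ^ (m * p) / t ^ (n * q) = t" using assms(4) by (simp add: pq)
  finally have 1: "x ^ m = t" .
  have "x ^ n = t ^ (n * p) / y ^ (n * q)"
    by (simp add: x_def power_divide mult.commute flip: power_mult)
  also have "t ^ (n * p) = y ^ (m * p)" using assms(3) by (simp add: power_mult)
  also have "y ^ (m * p) / y ^ (n * q) = y" using assms(5) by (simp add: pq)
  finally show ?thesis using 1 by blast
qed

text \<open>With \<open>d = gcd r s\<close>, the curve \<open>z^s = y^r\<close> on the torus splits according to the value of the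
  \<open>d\<close>-th root of unity \<open>z^(s/d) / y^(r/d)\<close>.  Each part is parametrized by a circle, because \<open>r/d\<close> and
  \<open>s/d\<close> are coprime.\<close>

theorem is_link_braid:
  assumes s: "0 < s" and r: "0 < r"
    and cont: "continuous_on (sphere 0 1) W"
    and inside: "\<And>z. cmod z = 1 \<Longrightarrow> cmod (W z) < 1"
    and inj: "\<And>z z'. cmod z = 1 \<Longrightarrow> cmod z' = 1 \<Longrightarrow> z ^ s = z' ^ s \<Longrightarrow> W z = W z' \<Longrightarrow> z = z'"
  shows "is_link (braid r s W)"
proof -
  define d where "d = gcd r s"
  define r' where "r' = r div d"
  define s' where "s' = s div d"
  have d0: "0 < d" using s by (simp add: d_def)
  have rd: "r = r' * d" "s = s' * d" by (simp_all add: r'_def s'_def d_def)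
  have cop: "coprime r' s'" unfolding r'_def s'_def d_def using s by (intro div_gcd_coprime) simp
  have r0: "0 < r'" and s0: "0 < s'" using r s rd by (auto intro: gr0I)
  define I where "I = {\<omega>::complex. \<omega> ^ d = 1}"
  have finI: "finite I" unfolding I_def using d0 by (intro card_ge_0_finite) (simp add: card_roots_unity_eq)
  have n1: "cmod x = 1" if "x ^ n = y" "cmod y = 1" "0 < n" for x y :: complex and n
  proof -
    have "cmod x ^ n = 1" using that by (metis norm_power)
    then show ?thesis using power_eq_iff_eq_base[of n "cmod x" 1] that(3) by simp
  qed
  have "\<exists>\<alpha>. \<alpha> ^ s' = \<omega> \<and> cmod \<alpha> = 1" if "\<omega> \<in> I" for \<omega>
  proof -
    have "cmod \<omega> = 1" using n1[of \<omega> d 1] that d0 by (simp add: I_def)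
    from ex_strand[OF s0 this, of 1] show ?thesis by auto
  qed
  then obtain \<alpha> where al: "\<And>\<omega>. \<omega> \<in> I \<Longrightarrow> \<alpha> \<omega> ^ s' = \<omega>" "\<And>\<omega>. \<omega> \<in> I \<Longrightarrow> cmod (\<alpha> \<omega>) = 1" by metis
  define Z where "Z \<omega> x = \<alpha> \<omega> * x ^ r'" for \<omega> x
  define \<gamma> where "\<gamma> \<omega> x = lift (W (Z \<omega> x)) (x ^ s')" for \<omega> x
  have Z1: "cmod (Z \<omega> x) = 1" if "\<omega> \<in> I" "cmod x = 1" for \<omega> x
    using al(2)[OF that(1)] that(2) by (simp add: Z_def norm_mult norm_power)
  have Zs': "Z \<omega> x ^ s' = \<omega> * (x ^ s') ^ r'" if "\<omega> \<in> I" for \<omega> x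
    using al(1)[OF that] by (simp add: Z_def power_mult_distrib mult.commute flip: power_mult)
  have Zs: "Z \<omega> x ^ s = (x ^ s') ^ r" if "\<omega> \<in> I" for \<omega> x
  proof -
    have "Z \<omega> x ^ s = (\<omega> * (x ^ s') ^ r') ^ d"
      unfolding rd(2) power_mult Zs'[OF that] ..
    also have "\<dots> = ((x ^ s') ^ r') ^ d"
      using that by (simp add: I_def power_mult_distrib)
    finally show ?thesis unfolding rd(1) power_mult .
  qed
  have eqD: "x ^ s' = x' ^ s'" "Z \<omega> x = Z \<omega>' x'"
    if "\<omega> \<in> I" "\<omega>' \<in> I" "cmod x = 1" "cmod x' = 1" "\<gamma> \<omega> x = \<gamma> \<omega>' x'" for \<omega> \<omega>' x x'
  proof -
    have n: "cmod (x ^ s') = 1" "cmod (x' ^ s') = 1" using that(3,4) by (simp_all add: norm_power)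
    note * = lift_braid_inj[where W = W, OF n Z1[OF that(1,3)] Z1[OF that(2,4)]
        Zs[OF that(1)] Zs[OF that(2)] inside inj that(5)[unfolded \<gamma>_def]]
    show "x ^ s' = x' ^ s'" by (rule *(1))
    show "Z \<omega> x = Z \<omega>' x'" by (rule *(2))
  qed
  have omega: "\<omega> = \<omega>'"
    if "\<omega> \<in> I" "\<omega>' \<in> I" "cmod x = 1" "cmod x' = 1" "\<gamma> \<omega> x = \<gamma> \<omega>' x'" for \<omega> \<omega>' x x'
  proof -
    have "\<omega> * (x ^ s') ^ r' = \<omega>' * (x ^ s') ^ r'"
      using Zs'[OF that(1), of x] Zs'[OF that(2), of x'] eqD[OF that] by metis
    moreover have "x \<noteq> 0" using that(3) by auto
    ultimately show ?thesis by simp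
  qed
  have inj\<gamma>: "inj_on (\<gamma> \<omega>) (sphere 0 1)" if w: "\<omega> \<in> I" for \<omega>
  proof (rule inj_onI)
    fix x x' :: complex
    assume x: "x \<in> sphere 0 1" "x' \<in> sphere 0 1" and e: "\<gamma> \<omega> x = \<gamma> \<omega> x'"
    then have x1: "cmod x = 1" "cmod x' = 1" by auto
    have nz: "x' \<noteq> 0" "\<alpha> \<omega> \<noteq> 0" using x1 al(2)[OF w] by auto
    have "x ^ s' = x' ^ s'" "x ^ r' = x' ^ r'"
      using eqD[OF w w x1 e] nz by (simp_all add: Z_def)
    then have "(x / x') ^ s' = 1" "(x / x') ^ r' = 1" using nz by (simp_all add: power_divide)
    then have "x / x' = 1" using root_of_unity_coprime cop by blast
    then show "x = x'" by simp
  qed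
  have cont\<gamma>: "continuous_on (sphere 0 1) (\<gamma> \<omega>)" if w: "\<omega> \<in> I" for \<omega>
  proof -
    have "continuous_on (sphere 0 1) (\<lambda>x. W (Z \<omega> x))"
      by (rule continuous_on_compose2[OF cont])
         (use Z1[OF w] in \<open>auto simp: Z_def intro!: continuous_intros\<close>)
    then show ?thesis unfolding \<gamma>_def lift_def by (intro continuous_intros)
  qed
  define C where "C \<omega> = \<gamma> \<omega> ` sphere 0 1" for \<omega>
  have homeo: "C \<omega> homeomorphic sphere (0::complex) 1" if "\<omega> \<in> I" for \<omega>
  proof -
    have "\<exists>g. homeomorphism (sphere 0 1) (C \<omega>) (\<gamma> \<omega>) g"
      by (rule homeomorphism_compact) (use cont\<gamma> inj\<gamma> that in \<open>auto simp: C_def\<close>)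
    then show ?thesis using homeomorphic_def homeomorphic_sym by blast
  qed
  have disj: "disjoint (C ` I)"
    unfolding disjoint_def
  proof (intro ballI impI)
    fix A B assume "A \<in> C ` I" "B \<in> C ` I" "A \<noteq> B"
    then obtain \<omega> \<omega>' where w: "\<omega> \<in> I" "\<omega>' \<in> I" "A = C \<omega>" "B = C \<omega>'" "\<omega> \<noteq> \<omega>'" by blast
    show "A \<inter> B = {}"
    proof (rule ccontr)
      assume "A \<inter> B \<noteq> {}"
      then obtain p where "p \<in> \<gamma> \<omega> ` sphere 0 1" "p \<in> \<gamma> \<omega>' ` sphere 0 1"
        unfolding w C_def by blast
      then obtain x x' where x: "x \<in> sphere 0 1" "x' \<in> sphere 0 1" "\<gamma> \<omega> x = \<gamma> \<omega>' x'" by force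
      then have "cmod x = 1" "cmod x' = 1" by simp_all
      from omega[OF w(1,2) this x(3)] w(5) show False by simp
    qed
  qed
  have "\<Union>(C ` I) = braid r s W"
  proof (intro equalityI subsetI)
    fix p assume "p \<in> \<Union>(C ` I)"
    then obtain \<omega> x where w: "\<omega> \<in> I" "cmod x = 1" "p = \<gamma> \<omega> x" by (auto simp: C_def)
    have "cmod (x ^ s') = 1" "W (Z \<omega> x) \<in> W ` strands r s (x ^ s')"
      using Zs[OF w(1)] w(2) by (auto simp: strands_def norm_power)
    then show "p \<in> braid r s W" unfolding braid_def fibred_def w(3) \<gamma>_def by blast
  next
    fix p assume "p \<in> braid r s W"
    then obtain z y where p: "cmod y = 1" "z \<in> strands r s y" "p = lift (W z) y"
      unfolding braid_def fibred_def by blast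
    have z: "cmod z = 1" "z ^ s = y ^ r" using norm_strand[OF s p(1,2)] p(2) by (auto simp: strands_def)
    have nz: "y \<noteq> 0" "z \<noteq> 0" using p(1) z(1) by auto
    define \<omega> where "\<omega> = z ^ s' / y ^ r'"
    have "\<omega> ^ d = z ^ s / y ^ r"
      unfolding \<omega>_def power_divide rd power_mult ..
    then have w: "\<omega> \<in> I" using z nz by (simp add: I_def)
    have a0: "\<alpha> \<omega> \<noteq> 0" using al(2)[OF w] by auto
    have "(z / \<alpha> \<omega>) ^ s' = y ^ r'"
      using al(1)[OF w] nz by (simp add: power_divide \<omega>_def)
    from ex_common_root[OF cop r0 this] obtain x where x: "x ^ r' = z / \<alpha> \<omega>" "x ^ s' = y"
      using nz a0 by auto
    have "cmod x = 1" using n1[OF x(2) p(1) s0] .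
    moreover have "p = \<gamma> \<omega> x" using x a0 by (simp add: p(3) \<gamma>_def Z_def)
    ultimately have "p \<in> C \<omega>" by (simp add: C_def)
    then show "p \<in> \<Union>(C ` I)" using w by blast
  qed
  moreover have "braid r s W \<subseteq> S3"
    unfolding braid_def
  proof (rule fibred_subset_S3)
    fix y :: complex assume "cmod y = 1"
    then show "W ` strands r s y \<subseteq> ball 0 1" using norm_strand[OF s] inside by auto
  qed
  moreover have "1 \<in> I" by (simp add: I_def)
  ultimately show ?thesis
    unfolding is_link_def using finI disj homeo
    by (intro conjI exI[of _ "C ` I"]) auto
qed

section \<open>Lemniscate links as closed braids over the circle\<close>

text \<open>The \<open>u\<close>-coordinate of stereographic projection on a half-plane bounded by the axis of the braid,
  where \<open>\<zeta>\<close> has the distance from the axis as its real part and the height as its imaginary part.\<close>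

definition half_plane_to_disc :: "complex \<Rightarrow> complex" where
  "half_plane_to_disc \<zeta> =
     Complex (((cmod \<zeta>)\<^sup>2 - 1) / ((cmod \<zeta>)\<^sup>2 + 1)) (2 * Im \<zeta> / ((cmod \<zeta>)\<^sup>2 + 1))"

lemma denom_pos: "0 < (cmod \<zeta>)\<^sup>2 + 1"
  by (simp add: add_nonneg_pos)

lemma norm_half_plane_to_disc:
  "1 - (cmod (half_plane_to_disc \<zeta>))\<^sup>2 = (2 * Re \<zeta> / ((cmod \<zeta>)\<^sup>2 + 1))\<^sup>2"
proof -
  define q where "q = (cmod \<zeta>)\<^sup>2"
  have q: "q = (Re \<zeta>)\<^sup>2 + (Im \<zeta>)\<^sup>2" by (simp add: q_def cmod_power2)
  have q1: "q + 1 \<noteq> 0" using denom_pos[of \<zeta>] by (simp add: q_def)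
  have "1 - (cmod (half_plane_to_disc \<zeta>))\<^sup>2 = 1 - (((q - 1) / (q + 1))\<^sup>2 + (2 * Im \<zeta> / (q + 1))\<^sup>2)"
    by (simp add: half_plane_to_disc_def cmod_power2 q_def)
  also have "\<dots> = ((q + 1)\<^sup>2 - (q - 1)\<^sup>2 - (2 * Im \<zeta>)\<^sup>2) / (q + 1)\<^sup>2"
    using q1 by (simp only: power_divide) (simp add: diff_divide_distrib)
  also have "(q + 1)\<^sup>2 - (q - 1)\<^sup>2 - (2 * Im \<zeta>)\<^sup>2 = (2 * Re \<zeta>)\<^sup>2"
    by (simp add: q power2_eq_square algebra_simps)
  finally show ?thesis by (simp add: q_def power_divide)
qed

lemma half_plane_to_disc_less_1:
  assumes "0 < Re \<zeta>"
  shows "cmod (half_plane_to_disc \<zeta>) < 1"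
proof -
  have "0 < (2 * Re \<zeta> / ((cmod \<zeta>)\<^sup>2 + 1))\<^sup>2"
    using assms denom_pos[of \<zeta>] by (intro zero_less_power divide_pos_pos) auto
  then have "(cmod (half_plane_to_disc \<zeta>))\<^sup>2 < 1" using norm_half_plane_to_disc[of \<zeta>] by linarith
  then show ?thesis by (simp add: abs_square_less_1)
qed

lemma half_plane_to_disc_inj:
  assumes "0 < Re \<zeta>" "0 < Re \<zeta>'" "half_plane_to_disc \<zeta> = half_plane_to_disc \<zeta>'"
  shows "\<zeta> = \<zeta>'"
proof -
  define q where "q = (cmod \<zeta>)\<^sup>2"
  define q' where "q' = (cmod \<zeta>')\<^sup>2"
  have qs: "0 < q + 1" "0 < q' + 1" using denom_pos by (simp_all add: q_def q'_def)
  have "(q - 1) / (q + 1) = (q' - 1) / (q' + 1)" "2 * Im \<zeta> / (q + 1) = 2 * Im \<zeta>' / (q' + 1)"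
    using assms(3) by (simp_all add: half_plane_to_disc_def q_def q'_def)
  moreover from this(1) qs have qq: "q = q'" by (simp add: field_simps)
  ultimately have im: "Im \<zeta> = Im \<zeta>'" using qs by simp
  have "(Re \<zeta>)\<^sup>2 = (Re \<zeta>')\<^sup>2"
    using qq im by (simp add: q_def q'_def cmod_power2)
  then have "Re \<zeta> = Re \<zeta>'" using assms(1,2) power2_eq_iff_nonneg[of "Re \<zeta>" "Re \<zeta>'"] by simp
  then show ?thesis using im by (simp add: complex_eq_iff)
qed

lemma stereo_half_plane:
  assumes "0 < \<rho>"
  shows "stereo (cos h * \<rho>, sin h * \<rho>, y) = lift (half_plane_to_disc (Complex \<rho> y)) (cis h)"
proof -
  let ?\<zeta> = "Complex \<rho> y"
  define q where "q = (cmod ?\<zeta>)\<^sup>2"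
  have q: "q = \<rho>\<^sup>2 + y\<^sup>2" by (simp add: q_def cmod_power2)
  have q1: "0 < q + 1" using denom_pos[of ?\<zeta>] by (simp add: q_def)
  have "(cos h * \<rho>)\<^sup>2 + (sin h * \<rho>)\<^sup>2 = ((sin h)\<^sup>2 + (cos h)\<^sup>2) * \<rho>\<^sup>2"
    by (simp only: power_mult_distrib distrib_right add.commute)
  then have sq: "(cos h * \<rho>)\<^sup>2 + (sin h * \<rho>)\<^sup>2 + y\<^sup>2 = q" by (simp add: q)
  have "stereo (cos h * \<rho>, sin h * \<rho>, y) =
      ((of_real (q - 1) + 2 * \<i> * of_real y) / of_real (q + 1),
       2 * (of_real (cos h * \<rho>) + \<i> * of_real (sin h * \<rho>)) / of_real (q + 1))"
    unfolding stereo_def Let_def split_conv sq ..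
  also have "(of_real (q - 1) + 2 * \<i> * of_real y) / of_real (q + 1) = half_plane_to_disc ?\<zeta>"
    using q1 by (simp add: half_plane_to_disc_def complex_eq_iff Re_divide_of_real Im_divide_of_real
        flip: q_def del: of_real_add of_real_diff)
  also have "2 * (of_real (cos h * \<rho>) + \<i> * of_real (sin h * \<rho>)) / of_real (q + 1) =
      of_real (2 * \<rho> / (q + 1)) * cis h"
    using q1 by (simp add: complex_eq_iff Re_divide_of_real Im_divide_of_real del: of_real_add)
  also have "2 * \<rho> / (q + 1) = sqrt (1 - (cmod (half_plane_to_disc ?\<zeta>))\<^sup>2)"
    using assms q1 by (simp add: norm_half_plane_to_disc flip: q_def)
  finally show ?thesis by (simp add: lift_def)
qed

lemma cis_Arg2pi:
  assumes "cmod y = 1"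
  shows "cis (Arg2pi y) = y" "Arg2pi y \<in> {0..2*pi}"
proof -
  show "cis (Arg2pi y) = y" using Arg2pi_eq[of y] assms by (simp add: cis_conv_exp)
  show "Arg2pi y \<in> {0..2*pi}" using Arg2pi_ge_0 Arg2pi_lt_2pi[of y] by (simp add: less_imp_le)
qed

lemma strands_eq_cis_image:
  assumes "0 < s"
  shows "lemniscate a b l ` strands r s (cis h) = (\<lambda>j. lemn_Z a b s r l 1 j h) ` {1..s}"
proof -
  have "lemniscate a b l ` strands r s (cis h) =
      lemniscate a b l ` (\<lambda>j. cis ((real r * h + 2 * pi * (real j - 1)) / real s)) ` {1..s}"
    using bij_betw_imp_surj_on[OF bij_betw_strands[OF assms, of r h]] by (simp only:)
  then show ?thesis
    unfolding image_image lemn_Z_eq_lemniscate of_real_1 mult_1_left .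
qed

text \<open>Stereographic projection respects the angle \<open>h\<close> around the axis, so that a closed braid in space
  goes to a closed braid over the circle.  Positivity carries over to the whole lemniscate, because
  its strands over all \<open>h\<close> together cover it when \<open>r > 0\<close>.\<close>

lemma stereo_closed_braid:
  assumes "0 < s" "0 < r"
    and pos: "\<And>j h. j \<in> {1..s} \<Longrightarrow> h \<in> {0..2*pi} \<Longrightarrow> 0 < R + Re (lemn_Z a b s r l 1 j h)"
  shows "stereo ` closed_braid a b s r l R =
      braid r s (\<lambda>z. half_plane_to_disc (of_real R + lemniscate a b l z))"
    and "\<And>z. cmod z = 1 \<Longrightarrow> 0 < R + Re (lemniscate a b l z)"
proof -
  have pt: "stereo (cos h * (R + Re Z), sin h * (R + Re Z), Im Z) =
      lift (half_plane_to_disc (of_real R + Z)) (cis h)" if "0 < R + Re Z" for h Z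
  proof -
    have "Complex (R + Re Z) (Im Z) = of_real R + Z" by (simp add: complex_eq_iff)
    then show ?thesis using stereo_half_plane[OF that, of h "Im Z"] by simp
  qed
  have "stereo ` closed_braid a b s r l R =
      {lift (half_plane_to_disc (of_real R + lemn_Z a b s r l 1 j h)) (cis h) | j h. j \<in> {1..s} \<and> h \<in> {0..2*pi}}"
    (is "?L = ?M")
  proof (intro equalityI subsetI)
    fix p assume "p \<in> ?L"
    then obtain j h where "j \<in> {1..s}" "h \<in> {0..2*pi}" "p = stereo (cos h * (R + Re (lemn_Z a b s r l 1 j h)),
        sin h * (R + Re (lemn_Z a b s r l 1 j h)), Im (lemn_Z a b s r l 1 j h))"
      unfolding closed_braid_def by blast
    then show "p \<in> ?M" using pt[OF pos] by blast
  next
    fix p assume "p \<in> ?M"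
    then obtain j h where jh: "j \<in> {1..s}" "h \<in> {0..2*pi}"
      "p = lift (half_plane_to_disc (of_real R + lemn_Z a b s r l 1 j h)) (cis h)" by blast
    show "p \<in> ?L"
      unfolding jh(3) pt[OF pos[OF jh(1,2)], symmetric] closed_braid_def using jh(1,2) by blast
  qed
  also have "\<dots> = braid r s (\<lambda>z. half_plane_to_disc (of_real R + lemniscate a b l z))" (is "_ = ?R")
  proof (intro equalityI subsetI)
    fix p assume "p \<in> ?M"
    then obtain j h where jh: "j \<in> {1..s}" "h \<in> {0..2*pi}"
      "p = lift (half_plane_to_disc (of_real R + lemn_Z a b s r l 1 j h)) (cis h)" by blast
    have "lemn_Z a b s r l 1 j h \<in> lemniscate a b l ` strands r s (cis h)"
      unfolding strands_eq_cis_image[OF assms(1)] using jh(1) by blast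
    then obtain z where z: "z \<in> strands r s (cis h)" "lemn_Z a b s r l 1 j h = lemniscate a b l z" by blast
    show "p \<in> ?R"
      unfolding braid_def fibred_def jh(3) z(2) using norm_cis[of h] z(1) by blast
  next
    fix p assume "p \<in> ?R"
    then obtain z y where zy: "cmod y = 1" "z \<in> strands r s y"
      "p = lift (half_plane_to_disc (of_real R + lemniscate a b l z)) y"
      unfolding braid_def fibred_def by blast
    note y = cis_Arg2pi[OF zy(1)]
    have "lemniscate a b l z \<in> (\<lambda>j. lemn_Z a b s r l 1 j (Arg2pi y)) ` {1..s}"
      unfolding strands_eq_cis_image[OF assms(1), symmetric] y(1) using zy(2) by blast
    then obtain j where "j \<in> {1..s}" "lemniscate a b l z = lemn_Z a b s r l 1 j (Arg2pi y)" by blast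
    then show "p \<in> ?M" using y zy(3) by (intro CollectI exI[of _ j] exI[of _ "Arg2pi y"]) simp
  qed
  finally show "?L = ?R" .
  fix z :: complex assume z: "cmod z = 1"
  obtain y where y: "y ^ r = z ^ s" "cmod y = 1" using ex_strand[OF assms(2) z] .
  have "z \<in> strands r s (cis (Arg2pi y))" using y(1) by (simp add: strands_def cis_Arg2pi(1)[OF y(2)])
  then have "lemniscate a b l z \<in> (\<lambda>j. lemn_Z a b s r l 1 j (Arg2pi y)) ` {1..s}"
    unfolding strands_eq_cis_image[OF assms(1), symmetric] by blast
  then show "0 < R + Re (lemniscate a b l z)" using pos cis_Arg2pi(2)[OF y(2)] by auto
qed

lemma continuous_on_half_plane_to_disc [continuous_intros]:
  "continuous_on S f \<Longrightarrow> continuous_on S (\<lambda>x. half_plane_to_disc (f x))"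
  unfolding half_plane_to_disc_def Complex_eq
  by (intro continuous_intros ballI) (use denom_pos in \<open>simp_all add: less_imp_neq[symmetric]\<close>)

text \<open>The set of admissible parameters \<open>(R, a, b)\<close> is convex, so that any two of them are joined by a
  segment.\<close>

lemma lemniscate_braids_isotopic:
  assumes "0 < s" "0 < l" "coprime s l" "0 < a" "0 < b" "0 < a'" "0 < b'"
    and pos: "\<And>z. cmod z = 1 \<Longrightarrow> 0 < R + Re (lemniscate a b l z)"
    and pos': "\<And>z. cmod z = 1 \<Longrightarrow> 0 < R' + Re (lemniscate a' b' l z)"
  shows "ambient_isotopic S3
      (braid r s (\<lambda>z. half_plane_to_disc (of_real R + lemniscate a b l z)))
      (braid r s (\<lambda>z. half_plane_to_disc (of_real R' + lemniscate a' b' l z)))"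
proof -
  define A where "A t = (1 - t) * a + t * a'" for t
  define B where "B t = (1 - t) * b + t * b'" for t
  define \<zeta> where "\<zeta> t z = of_real ((1 - t) * R + t * R') + lemniscate (A t) (B t) l z" for t z
  have AB: "0 < A t" "0 < B t" if "t \<in> {0..1}" for t
  proof -
    have "0 < (1 - t) * x + t * y" if "0 < x" "0 < y" for x y :: real
    proof (cases "t = 0")
      case False
      then show ?thesis using that \<open>t \<in> {0..1}\<close> by (intro add_nonneg_pos) auto
    qed (use that in simp)
    then show "0 < A t" "0 < B t" using assms by (simp_all add: A_def B_def)
  qed
  have Re: "0 < Re (\<zeta> t z)" if t: "t \<in> {0..1}" and z: "cmod z = 1" for t z
  proof -
    have "Re (\<zeta> t z) = (1 - t) * (R + Re (lemniscate a b l z)) + t * (R' + Re (lemniscate a' b' l z))"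
      by (simp add: \<zeta>_def lemniscate_def A_def algebra_simps)
    moreover have "0 < (1 - t) * (R + Re (lemniscate a b l z)) + t * (R' + Re (lemniscate a' b' l z))"
    proof (cases "t = 0")
      case False
      then show ?thesis using pos[OF z] pos'[OF z] t by (intro add_nonneg_pos) auto
    qed (use pos[OF z] in simp)
    ultimately show ?thesis by simp
  qed
  have "ambient_isotopic S3 (braid r s (\<lambda>z. half_plane_to_disc (\<zeta> 0 z))) (braid r s (\<lambda>z. half_plane_to_disc (\<zeta> 1 z)))"
  proof (rule braid_homotopy[OF assms(1)])
    show "continuous_on ({0..1} \<times> sphere 0 1) (\<lambda>(t, z). half_plane_to_disc (\<zeta> t z))"
      unfolding \<zeta>_def lemniscate_def A_def B_def split_beta by (intro continuous_intros) (use assms(2) in auto)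
    show "cmod (half_plane_to_disc (\<zeta> t z)) < 1" if "t \<in> {0..1}" "cmod z = 1" for t z
      using half_plane_to_disc_less_1[OF Re[OF that]] .
    show "z = z'" if "t \<in> {0..1}" "cmod z = 1" "cmod z' = 1" "z ^ s = z' ^ s"
        "half_plane_to_disc (\<zeta> t z) = half_plane_to_disc (\<zeta> t z')" for t z z'
    proof -
      have "\<zeta> t z = \<zeta> t z'"
        by (rule half_plane_to_disc_inj[OF Re[OF that(1,2)] Re[OF that(1,3)] that(5)])
      then have "lemniscate (A t) (B t) l z = lemniscate (A t) (B t) l z'" by (simp add: \<zeta>_def)
      then show ?thesis using lemniscate_inj[OF AB[OF that(1)] assms(2,3) that(2-4)] by blast
    qed
  qed
  then show ?thesis by (simp add: \<zeta>_def A_def B_def)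
qed

text \<open>Blowing up the half-plane at \<open>1\<close>: for \<open>\<tau> > 0\<close> the map is \<open>half_plane_to_disc (1 + \<tau>\<zeta>) / \<tau>\<close>, and it extends
  continuously to the identity at \<open>\<tau> = 0\<close>.\<close>

definition blow_up :: "real \<Rightarrow> complex \<Rightarrow> complex" where
  "blow_up \<tau> \<zeta> = (2 * \<zeta> + of_real (\<tau> * (cmod \<zeta>)\<^sup>2)) / of_real (1 + (cmod (1 + of_real \<tau> * \<zeta>))\<^sup>2)"

lemma blow_up_denom: "1 + (cmod z)\<^sup>2 \<noteq> 0" "0 < 1 + (cmod z)\<^sup>2"
  using denom_pos[of z] by (simp_all add: add.commute)

lemma blow_up_0: "blow_up 0 \<zeta> = \<zeta>"
  by (simp add: blow_up_def)

lemma blow_up_half_plane: "of_real \<tau> * blow_up \<tau> \<zeta> = half_plane_to_disc (1 + of_real \<tau> * \<zeta>)"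
proof -
  have "(cmod (1 + of_real \<tau> * \<zeta>))\<^sup>2 - 1 = \<tau> * (2 * Re \<zeta> + \<tau> * (cmod \<zeta>)\<^sup>2)"
    unfolding cmod_power2 by (simp add: power2_eq_square algebra_simps)
  then show ?thesis
    using blow_up_denom[of "1 + of_real \<tau> * \<zeta>"]
    by (simp add: blow_up_def half_plane_to_disc_def complex_eq_iff Re_divide_of_real Im_divide_of_real
        add.commute del: of_real_add)
qed

lemma blow_up_less_1:
  assumes "0 \<le> \<tau>" "\<tau> \<le> 1" "cmod \<zeta> \<le> 1 / 4"
  shows "cmod (blow_up \<tau> \<zeta>) < 1"
proof -
  have "cmod (2 * \<zeta> + of_real (\<tau> * (cmod \<zeta>)\<^sup>2)) \<le> 2 * cmod \<zeta> + \<tau> * (cmod \<zeta>)\<^sup>2"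
    by (rule norm_triangle_le) (use assms(1) in \<open>simp add: norm_mult norm_power\<close>)
  also have "\<dots> \<le> 2 * (1 / 4) + 1 * (1 / 4)\<^sup>2"
    using assms by (intro add_mono mult_mono power_mono) auto
  also have "\<dots> < 1 + (cmod (1 + of_real \<tau> * \<zeta>))\<^sup>2"
  proof -
    have "(1 / 4 :: real)\<^sup>2 = 1 / 16" by (simp add: power2_eq_square)
    then show ?thesis using zero_le_power2[of "cmod (1 + of_real \<tau> * \<zeta>)"] by linarith
  qed
  finally show ?thesis
    using blow_up_denom(2)[of "1 + of_real \<tau> * \<zeta>"]
    by (simp add: blow_up_def norm_divide del: of_real_add)
qed

lemma blow_up_inj:
  assumes "0 \<le> \<tau>" "\<tau> \<le> 1" "cmod \<zeta> \<le> 1 / 4" "cmod \<zeta>' \<le> 1 / 4" "blow_up \<tau> \<zeta> = blow_up \<tau> \<zeta>'"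
  shows "\<zeta> = \<zeta>'"
proof (cases "\<tau> = 0")
  case False
  have Re: "0 < Re (1 + of_real \<tau> * z)" if "cmod z \<le> 1 / 4" for z
  proof -
    have "\<tau> * cmod z \<le> 1 * (1 / 4)" using that assms(1,2) by (intro mult_mono) auto
    moreover have "\<bar>\<tau> * Re z\<bar> \<le> \<tau> * cmod z"
      using abs_Re_le_cmod[of z] assms(1) by (simp add: abs_mult mult_left_mono)
    ultimately show ?thesis by simp
  qed
  have "half_plane_to_disc (1 + of_real \<tau> * \<zeta>) = half_plane_to_disc (1 + of_real \<tau> * \<zeta>')"
    using assms(5) by (simp flip: blow_up_half_plane)
  from half_plane_to_disc_inj[OF Re[OF assms(3)] Re[OF assms(4)] this] False show ?thesis by simp
qed (use assms(5) in \<open>simp add: blow_up_0\<close>)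

text \<open>Inserting a braid of small diameter near the core of the solid torus by the identity of the disc
  or by the stereographic embedding of the half-plane makes no difference.\<close>

lemma small_braid_isotopic_half_plane:
  assumes s: "0 < s" and cont: "continuous_on (sphere 0 1) W"
    and small: "\<And>z. cmod z = 1 \<Longrightarrow> cmod (W z) \<le> 1 / 4"
    and inj: "\<And>z z'. cmod z = 1 \<Longrightarrow> cmod z' = 1 \<Longrightarrow> z ^ s = z' ^ s \<Longrightarrow> W z = W z' \<Longrightarrow> z = z'"
  shows "ambient_isotopic S3 (braid r s W) (braid r s (\<lambda>z. half_plane_to_disc (1 + W z)))"
proof -
  have "ambient_isotopic S3 (braid r s (\<lambda>z. blow_up 0 (W z))) (braid r s (\<lambda>z. blow_up 1 (W z)))"
  proof (rule braid_homotopy[OF s])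
    have "continuous_on ({0..1} \<times> sphere 0 1) (\<lambda>p::real \<times> complex. W (snd p))"
      by (rule continuous_on_compose2[OF cont]) (auto intro!: continuous_intros)
    then show "continuous_on ({0..1} \<times> sphere 0 1) (\<lambda>(\<tau>, z). blow_up \<tau> (W z))"
      unfolding blow_up_def split_beta
      by (intro continuous_intros) (use blow_up_denom(1) in \<open>auto simp del: of_real_add\<close>)
    show "cmod (blow_up \<tau> (W z)) < 1" if "\<tau> \<in> {0..1}" "cmod z = 1" for \<tau> z
      using that by (intro blow_up_less_1 small) auto
    show "z = z'" if "\<tau> \<in> {0..1}" "cmod z = 1" "cmod z' = 1" "z ^ s = z' ^ s"
        "blow_up \<tau> (W z) = blow_up \<tau> (W z')" for \<tau> z z'
      using that blow_up_inj[OF _ _ small[OF that(2)] small[OF that(3)] that(5)] inj by auto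
  qed
  moreover have "blow_up 1 \<zeta> = half_plane_to_disc (1 + \<zeta>)" for \<zeta>
    using blow_up_half_plane[of 1 \<zeta>] by simp
  ultimately show ?thesis by (simp add: blow_up_0)
qed

lemma lemniscate_scale: "of_real lam * lemniscate a b l z = lemniscate (lam * a) (lam * b) l z"
  by (simp add: lemniscate_def algebra_simps)

section \<open>Zero sets of the polynomials are lemniscate links\<close>

theorem theorem3p1:
  fixes s r l :: nat and a b :: real
  assumes "0 < s" and "0 < r" and "0 < l" and "coprime s l" and "0 < a" and "0 < b"
  shows "\<exists>\<epsilon>>0. \<forall>lam::real. 0 < lam \<and> lam < \<epsilon> \<longrightarrow>
           is_link (lemn_f a b s r l lam -` {0} \<inter> S3) \<and>
           (\<forall>K. is_lemniscate_link s r l K \<longrightarrow>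
                ambient_isotopic S3 (lemn_f a b s r l lam -` {0} \<inter> S3) K)"
proof -
  define Z where "Z = lemniscate a b l"
  have contZ: "continuous_on (sphere 0 1) Z"
    unfolding Z_def lemniscate_def using assms(3) by (intro continuous_intros) auto
  have injZ: "z = z'" if "cmod z = 1" "cmod z' = 1" "z ^ s = z' ^ s" "Z z = Z z'" for z z'
    using lemniscate_inj[OF assms(5,6,3,4)] that by (simp add: Z_def)
  define g where "g u v = lemn_f a b s r l 1 (u, v)" for u v
  obtain K c where K: "finite K" and gK: "\<And>u v. g u v = u ^ s + lower_terms s K c v u"
    using lemn_f_expansion[OF assms(1,3), of a b r] unfolding g_def lower_terms_def by blast
  have unit: "g u y = (\<Prod>z\<in>strands r s y. u - Z z)" if "cmod y = 1" for u y
    using lemn_f_unit_circle[OF assms(1,3) that] by (simp add: g_def Z_def)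
  from zero_set_isotopic_braid[OF assms(1) K gK unit contZ injZ] obtain \<epsilon>0 where
    e0: "0 < \<epsilon>0" "\<And>lam. 0 < lam \<Longrightarrow> lam < \<epsilon>0 \<Longrightarrow>
      ambient_isotopic S3 {p \<in> S3. g (fst p / of_real lam) (snd p) = 0} (braid r s (\<lambda>z. of_real lam * Z z))"
    by blast
  define B where "B = a + b / l"
  have B: "0 < B" using assms by (simp add: B_def add_pos_pos)
  have ZB: "cmod (Z z) \<le> B" if "cmod z = 1" for z
  proof -
    have "\<bar>Re z\<bar> \<le> 1" "\<bar>Im (z ^ l)\<bar> \<le> 1"
      using abs_Re_le_cmod[of z] abs_Im_le_cmod[of "z ^ l"] that by (simp_all add: norm_power)
    then have "a * \<bar>Re z\<bar> \<le> a * 1" "b / l * \<bar>Im (z ^ l)\<bar> \<le> b / l * 1"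
      using assms by (intro mult_left_mono; simp)+
    moreover have "cmod (Z z) \<le> a * \<bar>Re z\<bar> + b / l * \<bar>Im (z ^ l)\<bar>"
      unfolding Z_def lemniscate_def using assms
      by (intro order_trans[OF norm_triangle_ineq]) (simp add: norm_mult abs_mult del: of_real_mult of_real_divide)
    ultimately show ?thesis by (simp add: B_def)
  qed
  define \<epsilon> where "\<epsilon> = min \<epsilon>0 (1 / (4 * B))"
  have "0 < \<epsilon>" using e0(1) B by (simp add: \<epsilon>_def)
  moreover have "is_link (lemn_f a b s r l lam -` {0} \<inter> S3) \<and>
      (\<forall>K. is_lemniscate_link s r l K \<longrightarrow> ambient_isotopic S3 (lemn_f a b s r l lam -` {0} \<inter> S3) K)"
    if lam: "0 < lam" "lam < \<epsilon>" for lam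
  proof -
    let ?F = "lemn_f a b s r l lam -` {0} \<inter> S3"
    define W where "W z = of_real lam * Z z" for z
    have "lemn_f a b s r l lam (u, v) = of_real lam ^ s * g (u / of_real lam) v" for u v
      using lemn_f_scale[OF assms(1,3), of lam a b r "u / of_real lam" v] lam(1) by (simp add: g_def)
    then have "?F = {p \<in> S3. g (fst p / of_real lam) (snd p) = 0}"
      using lam(1) by auto
    then have FW: "ambient_isotopic S3 ?F (braid r s W)"
      using e0(2)[of lam] lam by (simp add: \<epsilon>_def W_def[abs_def])
    have contW: "continuous_on (sphere 0 1) W" unfolding W_def by (intro continuous_intros contZ)
    have small: "cmod (W z) \<le> 1 / 4" if "cmod z = 1" for z
    proof -
      have "lam \<le> 1 / (4 * B)" using lam(2) by (simp add: \<epsilon>_def)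
      then have "lam * B \<le> 1 / 4" using B by (simp add: field_simps)
      moreover have "cmod (W z) \<le> lam * B"
        unfolding W_def norm_mult using ZB[OF that] lam(1) by (simp add: mult_left_mono)
      ultimately show ?thesis by linarith
    qed
    have injW: "z = z'" if "cmod z = 1" "cmod z' = 1" "z ^ s = z' ^ s" "W z = W z'" for z z'
      using injZ[OF that(1-3)] that(4) lam(1) by (simp add: W_def)
    have "cmod (W z) < 1" if "cmod z = 1" for z using small[OF that] by simp
    from is_link_braid[OF assms(1,2) contW this injW] have "is_link (braid r s W)" .
    then have "is_link ?F" by (rule is_link_ambient_isotopic[OF _ ambient_isotopic_sym[OF FW]])
    moreover have "ambient_isotopic S3 ?F K" if K: "is_lemniscate_link s r l K" for K
    proof -
      obtain a' b' R' where ab: "0 < a'" "0 < b'" and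
        pos: "\<And>j h. j \<in> {1..s} \<Longrightarrow> h \<in> {0..2*pi} \<Longrightarrow> 0 < R' + Re (lemn_Z a' b' s r l 1 j h)" and
        KE: "K = stereo ` closed_braid a' b' s r l R'"
        using K unfolding is_lemniscate_link_def by blast
      have KB: "K = braid r s (\<lambda>z. half_plane_to_disc (of_real R' + lemniscate a' b' l z))"
        unfolding KE by (rule stereo_closed_braid(1)[OF assms(1,2) pos])
      have pos': "0 < R' + Re (lemniscate a' b' l z)" if "cmod z = 1" for z
        by (rule stereo_closed_braid(2)[OF assms(1,2) pos that])
      have W: "W z = lemniscate (lam * a) (lam * b) l z" for z
        by (simp add: W_def Z_def lemniscate_scale)
      have pos1: "0 < 1 + Re (lemniscate (lam * a) (lam * b) l z)" if "cmod z = 1" for z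
        using small[OF that] abs_Re_le_cmod[of "W z"] by (simp add: W)
      have "ambient_isotopic S3 (braid r s W) (braid r s (\<lambda>z. half_plane_to_disc (1 + W z)))"
        by (rule small_braid_isotopic_half_plane[OF assms(1) contW small injW])
      also have "(\<lambda>z. half_plane_to_disc (1 + W z)) =
          (\<lambda>z. half_plane_to_disc (of_real 1 + lemniscate (lam * a) (lam * b) l z))"
        by (simp add: W)
      finally have WR: "ambient_isotopic S3 (braid r s W)
          (braid r s (\<lambda>z. half_plane_to_disc (of_real 1 + lemniscate (lam * a) (lam * b) l z)))" .
      have "ambient_isotopic S3
          (braid r s (\<lambda>z. half_plane_to_disc (of_real 1 + lemniscate (lam * a) (lam * b) l z))) K"
        unfolding KB
        by (rule lemniscate_braids_isotopic[OF assms(1,3,4) _ _ ab pos1 pos']) (use lam assms in auto)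
      from ambient_isotopic_trans[OF ambient_isotopic_trans[OF FW WR] this] show ?thesis .
    qed
    ultimately show ?thesis by blast
  qed
  ultimately show ?thesis by blast
qed

end
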